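(* Let $X$ be a compact geodesic space with $b_1(X)<\infty$ and Hausdorff dimension two. Let $p$ be a point in $X$ and let $f:X \to \mathbb{R}$, $f(x) = d_X(p,x)$. Then $$\mathrm{dis}(\pi_f) \leq 8\, (b_1(X)+1)^{3/2} \sqrt{\mathcal{H}^2(X)}, $$ where $\mathcal{H}^2(X)$ denotes the two-dimensional Hausdorff measure of $X$ and $\pi_f : X\to R_p$ is the Reeb quotient map.
   Context: Geodesic space: a metric space in which any two points are joined by a path whose length equals their distance. $b_1$ denotes the first Betti number, i.e. the dimension of first singular homology with real coefficients. $\mathcal{H}^2$ is normalized so that it agrees with Lebesgue measure on $\mathbb{R}^2$. $R_p$ denotes the Reeb metric graph of $f=d_X(p,\cdot)$: as a topological space it is the quotient of $X$ identifying points that lie in the same connected component of a fiber $f^{-1}(c)$, $c\in\mathbb{R}$; the quotient map is $\pi_f$, the class of $x$ is $[x]=\pi_f(x)$, and $\bar f([x])=f(x)$. It is endowed with the Reeb metric $d_p([x],[y]) := \inf_\beta \mathrm{length}_{\mathbb{R}}(\bar f\circ\beta)$, where $\beta$ ranges over all continuous paths in the quotient space from $[x]$ to $[y]$, and $\mathrm{length}_{\mathbb{R}}$ is the length (total variation) of a path in $\mathbb{R}$. For a map $\phi:X\to Z$ of metric spaces, $\mathrm{dis}(\phi):=\sup_{x,x'\in X}|d_X(x,x')-d_Z(\phi(x),\phi(x'))|$. *)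

theory Defs
  imports "HOL-Analysis.Analysis" "HOL-Homology.Homology"
begin

section \<open>Length and geodesic spaces\<close>

definition path_length :: "(real \<Rightarrow> 'a::metric_space) \<Rightarrow> ennreal" where
  "path_length g =
     (SUP (n, t) \<in> {(n::nat, t::nat \<Rightarrow> real). mono_on {..n} t \<and> t ` {..n} \<subseteq> {0..1}}.
        \<Sum>i<n. ennreal (dist (g (t i)) (g (t (Suc i)))))"

definition geodesic_space :: "'a::metric_space set \<Rightarrow> bool" where
  "geodesic_space S \<longleftrightarrow>
     (\<forall>x\<in>S. \<forall>y\<in>S. \<exists>g. path g \<and> path_image g \<subseteq> S \<and> pathstart g = x \<and> pathfinish g = y \<and>
        path_length g = ennreal (dist x y))"


section \<open>Hausdorff measure and dimension\<close>

text \<open>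
  The factor \<open>unit_ball_vol s / 2 powr s\<close> makes the \<open>n\<close>-dimensional measure agree with Lebesgue
  measure on \<open>n\<close>-dimensional Euclidean space.  The case \<open>s = 0\<close> is separate because
  \<open>0 powr 0 = 0\<close>, whereas a nonempty set of diameter 0 must have weight 1.
\<close>

definition hausdorff_weight :: "real \<Rightarrow> 'a::metric_space set \<Rightarrow> ennreal" where
  "hausdorff_weight s U =
     (if U = {} then 0 else if s = 0 then 1
      else ennreal (unit_ball_vol s * (diameter U / 2) powr s))"

text \<open>Boundedness is required since \<open>diameter\<close> carries no information on unbounded sets.\<close>

definition hausdorff_measure :: "real \<Rightarrow> 'a::metric_space set \<Rightarrow> ennreal" where
  "hausdorff_measure s A =
     (SUP \<delta> \<in> {0<..}.
        INF U \<in> {U :: nat \<Rightarrow> 'a set. A \<subseteq> (\<Union>i. U i) \<and> (\<forall>i. bounded (U i) \<and> diameter (U i) \<le> \<delta>)}.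
          suminf (\<lambda>i. hausdorff_weight s (U i)))"

definition hausdorff_dim :: "'a::metric_space set \<Rightarrow> ennreal" where
  "hausdorff_dim A = Inf {ennreal s | s. 0 \<le> s \<and> hausdorff_measure s A = 0}"


section \<open>Betti numbers: singular homology with real coefficients\<close>

instantiation poly_mapping :: (type, real_vector) real_vector
begin

lift_definition scaleR_poly_mapping :: "real \<Rightarrow> ('a \<Rightarrow>\<^sub>0 'b) \<Rightarrow> 'a \<Rightarrow>\<^sub>0 'b"
  is "\<lambda>r c k. r *\<^sub>R c k"
  by (rule finite_subset [rotated]) auto

instance
  by standard (transfer; simp add: fun_eq_iff algebra_simps)+

end

type_synonym 'a real_chain = "((nat \<Rightarrow> real) \<Rightarrow> 'a) \<Rightarrow>\<^sub>0 real"

definition real_singular_chains :: "nat \<Rightarrow> 'a topology \<Rightarrow> 'a real_chain set" where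
  "real_singular_chains n X = {c. Poly_Mapping.keys c \<subseteq> singular_simplex_set n X}"

text \<open>
  The counterpart for real coefficients of the constant \<open>chain_boundary\<close>, which is for integer
  coefficients.
\<close>

definition real_chain_boundary :: "nat \<Rightarrow> 'a real_chain \<Rightarrow> 'a real_chain" where
  "real_chain_boundary n c =
     (if n = 0 then 0
      else \<Sum>\<sigma>\<in>Poly_Mapping.keys c. \<Sum>k\<le>n.
             Poly_Mapping.single (singular_face n k \<sigma>) ((- 1) ^ k * Poly_Mapping.lookup c \<sigma>))"

definition real_cycles :: "nat \<Rightarrow> 'a topology \<Rightarrow> 'a real_chain set" where
  "real_cycles n X = {c \<in> real_singular_chains n X. real_chain_boundary n c = 0}"

definition real_boundaries :: "nat \<Rightarrow> 'a topology \<Rightarrow> 'a real_chain set" where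
  "real_boundaries n X = real_chain_boundary (Suc n) ` real_singular_chains (Suc n) X"

text \<open>
  For subspaces \<open>W \<subseteq> V\<close>, this says that the classes in \<open>V / W\<close> of the elements of \<open>B\<close> are
  pairwise distinct and form a basis of \<open>V / W\<close>.
\<close>

definition quotient_basis :: "'v::real_vector set \<Rightarrow> 'v set \<Rightarrow> 'v set \<Rightarrow> bool" where
  "quotient_basis V W B \<longleftrightarrow>
     B \<subseteq> V \<and> independent B \<and> span B \<inter> W = {0} \<and> V \<subseteq> span (B \<union> W)"

text \<open>
  All bases have the same cardinality, so the infimum just selects it; it is \<open>\<infinity>\<close> if there is no
  finite basis.
\<close>

definition quotient_dim :: "'v::real_vector set \<Rightarrow> 'v set \<Rightarrow> enat" where
  "quotient_dim V W = Inf {enat (card B) | B. finite B \<and> quotient_basis V W B}"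

definition betti_number :: "nat \<Rightarrow> 'a topology \<Rightarrow> enat" where
  "betti_number n X = quotient_dim (real_cycles n X) (real_boundaries n X)"


section \<open>The Reeb quotient and its metric\<close>

definition quotient_topology :: "'a topology \<Rightarrow> ('a \<Rightarrow> 'b) \<Rightarrow> 'b topology" where
  "quotient_topology X q =
     topology (\<lambda>U. U \<subseteq> q ` topspace X \<and> openin X {x \<in> topspace X. q x \<in> U})"

lemma openin_quotient_topology:
  "openin (quotient_topology X q) U \<longleftrightarrow>
     U \<subseteq> q ` topspace X \<and> openin X {x \<in> topspace X. q x \<in> U}"
proof -
  have "istopology (\<lambda>U. U \<subseteq> q ` topspace X \<and> openin X {x \<in> topspace X. q x \<in> U})"
    unfolding istopology_def
  proof (intro conjI allI impI)
    fix S T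
    assume "S \<subseteq> q ` topspace X \<and> openin X {x \<in> topspace X. q x \<in> S}"
      and "T \<subseteq> q ` topspace X \<and> openin X {x \<in> topspace X. q x \<in> T}"
    then have "openin X ({x \<in> topspace X. q x \<in> S} \<inter> {x \<in> topspace X. q x \<in> T})"
      by blast
    moreover have "{x \<in> topspace X. q x \<in> S} \<inter> {x \<in> topspace X. q x \<in> T}
        = {x \<in> topspace X. q x \<in> S \<inter> T}"
      by blast
    ultimately show "openin X {x \<in> topspace X. q x \<in> S \<inter> T}"
      by simp
  next
    fix \<K>
    assume *: "\<forall>K\<in>\<K>. K \<subseteq> q ` topspace X \<and> openin X {x \<in> topspace X. q x \<in> K}"
    then have "openin X (\<Union>K\<in>\<K>. {x \<in> topspace X. q x \<in> K})"
      by blast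
    moreover have "(\<Union>K\<in>\<K>. {x \<in> topspace X. q x \<in> K}) = {x \<in> topspace X. q x \<in> \<Union>\<K>}"
      by blast
    ultimately show "openin X {x \<in> topspace X. q x \<in> \<Union>\<K>}"
      by simp
  qed auto
  then show ?thesis
    by (simp add: quotient_topology_def)
qed

lemma topspace_quotient_topology: "topspace (quotient_topology X q) = q ` topspace X"
proof
  show "topspace (quotient_topology X q) \<subseteq> q ` topspace X"
    using openin_topspace [of "quotient_topology X q"] unfolding openin_quotient_topology ..
  have "{x \<in> topspace X. q x \<in> q ` topspace X} = topspace X"
    by blast
  then have "openin (quotient_topology X q) (q ` topspace X)"
    by (simp add: openin_quotient_topology)
  then show "q ` topspace X \<subseteq> topspace (quotient_topology X q)"
    by (rule openin_subset)
qed

lemma quotient_map_quotient_topology: "quotient_map X (quotient_topology X q) q"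
  by (simp add: quotient_map_def topspace_quotient_topology openin_quotient_topology)

definition reeb_map :: "('a::topological_space \<Rightarrow> real) \<Rightarrow> 'a \<Rightarrow> 'a set" where
  "reeb_map f x = connected_component_set (f -` {f x}) x"

definition reeb_space :: "('a::topological_space \<Rightarrow> real) \<Rightarrow> 'a set topology" where
  "reeb_space f = quotient_topology euclidean (reeb_map f)"

definition reeb_fun :: "('a::topological_space \<Rightarrow> real) \<Rightarrow> 'a set \<Rightarrow> real" where
  "reeb_fun f c = the_elem (f ` c)"

lemma reeb_fun_reeb_map: "reeb_fun f (reeb_map f x) = f x"
proof -
  have "x \<in> reeb_map f x"
    by (simp add: reeb_map_def)
  moreover have "reeb_map f x \<subseteq> f -` {f x}"
    unfolding reeb_map_def by (rule connected_component_subset)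
  ultimately have "f ` reeb_map f x = {f x}"
    by auto
  then show ?thesis
    by (simp add: reeb_fun_def)
qed

definition reeb_dist :: "('a::topological_space \<Rightarrow> real) \<Rightarrow> 'a set \<Rightarrow> 'a set \<Rightarrow> ennreal" where
  "reeb_dist f a b =
     (INF \<beta> \<in> {\<beta>. pathin (reeb_space f) \<beta> \<and> \<beta> 0 = a \<and> \<beta> 1 = b}. path_length (reeb_fun f \<circ> \<beta>))"


section \<open>Distortion\<close>

definition distortion :: "('a::metric_space \<Rightarrow> 'b) \<Rightarrow> ('b \<Rightarrow> 'b \<Rightarrow> ennreal) \<Rightarrow> ennreal" where
  "distortion \<phi> d = (SUP x. SUP y. e2ennreal \<bar>ereal (dist x y) - enn2ereal (d (\<phi> x) (\<phi> y))\<bar>)"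

definition ennreal_sqrt :: "ennreal \<Rightarrow> ennreal" where
  "ennreal_sqrt x = (if x = \<infinity> then \<infinity> else ennreal (sqrt (enn2real x)))"

end

theory Submission
  imports Defs "HOL-Complex_Analysis.Winding_Numbers"
begin

text \<open>
  Write \<open>b\<^sub>1\<close> for the first Betti number, \<open>N = b\<^sub>1 + 1\<close> and \<open>H\<close> for the area of \<open>X\<close>.  As \<open>f\<close> is 1-Lipschitz,
  the image of a geodesic of \<open>X\<close> in the Reeb quotient is no longer than the geodesic, so the Reeb
  distance is at most the distance in \<open>X\<close>.  The substance is the opposite inequality up to an error:
  a path of variation \<open>V\<close> from \<open>[x]\<close> to \<open>[y]\<close> in the quotient forces \<open>dist x y\<close> to be at most
  \<open>V + 8 N\<^bsup>3/2\<^esup> sqrt H\<close>.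

  Every point descends along a geodesic to \<open>p\<close>, and moving down costs exactly the drop in height.  A
  path in the quotient is therefore imitated in \<open>X\<close> at no extra cost as long as it descends, read from
  one of its ends, and the geodesic chosen does not leave it for a different branch.  To count the
  failures, the quotient is replaced by a graph whose vertices are the components of overlapping
  level strips of half-width \<open>e\<close>.  A path of variation \<open>V\<close> becomes a walk with about \<open>V / e\<close> steps
  (\<open>reeb_path_walk\<close>), and repetitions can be cut out of the walk.  Failures happen only at vertices below
  which there is more than one branch; highest points of a walk without repetitions are among them.
  Together with the detours inside the lowest vertices, the total cost is at most \<open>3 k + 1\<close> diameters of
  vertices if the walk meets \<open>k\<close> such vertices (\<open>injective_walk_dist_le\<close>).

  There are at most \<open>b\<^sub>1\<close> branching vertices, because each one carries a loop that descends to \<open>p\<close> along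
  two branches.  Such loops are detected by circle-valued maps that wind once around the circle across
  one component of a strip.  The resulting pairing with 1-cycles is triangular with respect to
  the height (\<open>independent_strip_components_card_le\<close>).  The classical statement behind this is that a
  Mayer-Vietoris sequence bounds the number of components of a level set by the first homology; here the
  cohomology classes are written down directly, which requires no regularity of \<open>X\<close> beyond
  being geodesic.

  The diameter \<open>D\<close> of a vertex is controlled by area.  By the same count of components, the vertex
  descends into at most \<open>N\<close> components of the level at depth \<open>s\<close> below it, and the neighbourhoods of
  radius \<open>s\<close> of these cover the vertex.  Their diameters thus add up to at least \<open>D - 2 N s\<close>.  Integrating
  over \<open>s\<close> gives \<open>D\<^sup>2 / (4 N) \<le> 4 / pi * H\<close> up to an error of order \<open>e\<close>
  (\<open>strip_component_dist_sq_le\<close>).  In the limit the total loss is at most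
  \<open>3 N * sqrt (16 N H / pi)\<close>, which is less than the bound claimed unless \<open>H = 0\<close>.
\<close>

section \<open>Linear algebra over a quotient\<close>

text \<open>
  Lower bounds for a Betti number come from exhibiting cycles together with cocycles that separate
  them.  The pairing matrix only has to be triangular with respect to some real-valued height, because
  a linear relation is refuted by the functional of a highest element that occurs in it.
\<close>

lemma quotient_basis_card_bound:
  fixes \<gamma> :: "'i \<Rightarrow> 'v::real_vector" and \<Phi> :: "'i \<Rightarrow> 'v \<Rightarrow> real" and key :: "'i \<Rightarrow> real"
  assumes B: "finite B" "quotient_basis V W B"
    and I: "finite I" "\<And>i. i \<in> I \<Longrightarrow> \<gamma> i \<in> V"
    and lin: "\<And>i. i \<in> I \<Longrightarrow> linear (\<Phi> i)"
    and W: "\<And>i w. i \<in> I \<Longrightarrow> w \<in> W \<Longrightarrow> \<Phi> i w = 0"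
    and diag: "\<And>i. i \<in> I \<Longrightarrow> \<Phi> i (\<gamma> i) = 1"
    and tri: "\<And>i j. \<lbrakk>i \<in> I; j \<in> I; i \<noteq> j; key i \<le> key j\<rbrakk> \<Longrightarrow> \<Phi> j (\<gamma> i) = 0"
  shows "card I \<le> card B"
proof -
  have "\<exists>b. b \<in> span B \<and> (\<forall>j\<in>I. \<Phi> j b = \<Phi> j (\<gamma> i))" if i: "i \<in> I" for i
  proof -
    have "\<gamma> i \<in> span (B \<union> W)"
      using B(2) I(2)[OF i] unfolding quotient_basis_def by blast
    then obtain b w where bw: "b \<in> span B" "w \<in> span W" "\<gamma> i = b + w"
      unfolding span_Un by blast
    have "\<Phi> j w = 0" if "j \<in> I" for j
      using linear_eq_0_on_span[OF lin[OF that] W[OF that] bw(2)] .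
    then have "\<Phi> j b = \<Phi> j (\<gamma> i)" if "j \<in> I" for j
      using that lin[OF that] bw(3) by (simp add: linear_add)
    with bw(1) show ?thesis by blast
  qed
  then obtain \<beta> where \<beta>: "\<And>i. i \<in> I \<Longrightarrow> \<beta> i \<in> span B"
    and \<Phi>\<beta>: "\<And>i j. i \<in> I \<Longrightarrow> j \<in> I \<Longrightarrow> \<Phi> j (\<beta> i) = \<Phi> j (\<gamma> i)"
    by metis
  have inj: "inj_on \<beta> I"
  proof (rule inj_onI, rule ccontr)
    fix i j assume ij: "i \<in> I" "j \<in> I" "\<beta> i = \<beta> j" "i \<noteq> j"
    show False
      using \<Phi>\<beta>[of i j] \<Phi>\<beta>[of j i] \<Phi>\<beta>[of i i] \<Phi>\<beta>[of j j] diag[of i] diag[of j] tri[of i j] tri[of j i] ij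
      by (cases "key i \<le> key j") auto
  qed
  have "independent (\<beta> ` I)"
  proof (rule independent_if_scalars_zero)
    show "finite (\<beta> ` I)" using I(1) by simp
    fix c x assume c: "(\<Sum>x\<in>\<beta> ` I. c x *\<^sub>R x) = 0" and x: "x \<in> \<beta> ` I"
    define u where "u i = c (\<beta> i)" for i
    have sum0: "(\<Sum>i\<in>I. u i *\<^sub>R \<beta> i) = 0"
      using c by (simp add: sum.reindex[OF inj] u_def)
    define J where "J = {i \<in> I. u i \<noteq> 0}"
    have "J = {}"
    proof (rule ccontr)
      assume ne: "J \<noteq> {}"
      have finJ: "finite J" using I(1) by (simp add: J_def)
      have "Max (key ` J) \<in> key ` J" using finJ ne by simp
      then obtain j where j: "j \<in> J" "key j = Max (key ` J)" by auto
      have jmax: "key i \<le> key j" if "i \<in> J" for i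
        using that finJ j(2) by simp
      have jI: "j \<in> I" "u j \<noteq> 0" using j(1) by (auto simp: J_def)
      interpret linear "\<Phi> j" by (rule lin[OF jI(1)])
      have "0 = \<Phi> j (\<Sum>i\<in>I. u i *\<^sub>R \<beta> i)" by (simp add: sum0 zero)
      also have "\<dots> = (\<Sum>i\<in>I. u i * \<Phi> j (\<gamma> i))"
        using \<Phi>\<beta> jI(1) by (simp add: sum scale)
      also have "\<dots> = (\<Sum>i\<in>{j}. u i * \<Phi> j (\<gamma> i))"
      proof (rule sum.mono_neutral_right)
        show "\<forall>i\<in>I - {j}. u i * \<Phi> j (\<gamma> i) = 0"
          using jI(1) tri jmax unfolding J_def by fastforce
      qed (use I(1) jI in auto)
      finally show False using diag[OF jI(1)] jI(2) by simp
    qed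
    then show "c x = 0" using x by (auto simp: J_def u_def)
  qed
  then have "card (\<beta> ` I) \<le> card B"
    using independent_span_bound[OF B(1)] \<beta> by blast
  then show ?thesis by (simp add: card_image[OF inj])
qed

lemma finite_betti_number_obtains_basis:
  assumes "quotient_dim V W < \<infinity>"
  obtains B where "finite B" "quotient_basis V W B" "quotient_dim V W = enat (card B)"
proof -
  let ?S = "{enat (card B) | B. finite B \<and> quotient_basis V W B}"
  have "?S \<noteq> {}"
  proof
    assume e: "?S = {}"
    have "quotient_dim V W = \<infinity>" unfolding quotient_dim_def e by (simp add: Inf_enat_def)
    then show False using assms by simp
  qed
  then obtain k where "k \<in> ?S" by (meson ex_in_conv)
  then have "Inf ?S \<in> ?S" by (rule wellorder_InfI)
  then show ?thesis using that unfolding quotient_dim_def by blast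
qed

section \<open>Circle-valued maps as real cocycles\<close>

definition chain_functional :: "(((nat \<Rightarrow> real) \<Rightarrow> 'a) \<Rightarrow> real) \<Rightarrow> 'a real_chain \<Rightarrow> real" where
  "chain_functional \<omega> c = (\<Sum>\<sigma>\<in>Poly_Mapping.keys c. Poly_Mapping.lookup c \<sigma> * \<omega> \<sigma>)"

lemma chain_functional_superset:
  assumes "finite A" "Poly_Mapping.keys c \<subseteq> A"
  shows "chain_functional \<omega> c = (\<Sum>\<sigma>\<in>A. Poly_Mapping.lookup c \<sigma> * \<omega> \<sigma>)"
  unfolding chain_functional_def
  by (rule sum.mono_neutral_left) (use assms in \<open>auto simp: in_keys_iff\<close>)

lemma lookup_scaleR_poly_mapping:
  "Poly_Mapping.lookup (r *\<^sub>R c) x = r *\<^sub>R Poly_Mapping.lookup c x"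
  by transfer simp

lemma linear_chain_functional: "linear (chain_functional \<omega>)"
proof (rule linearI)
  fix c d :: "'a real_chain"
  let ?A = "Poly_Mapping.keys c \<union> Poly_Mapping.keys d"
  have "Poly_Mapping.keys (c + d) \<subseteq> ?A" by (rule keys_add)
  then show "chain_functional \<omega> (c + d) = chain_functional \<omega> c + chain_functional \<omega> d"
    by (simp add: chain_functional_superset[of ?A] lookup_add distrib_right sum.distrib)
next
  fix r and c :: "'a real_chain"
  have "Poly_Mapping.keys (r *\<^sub>R c) \<subseteq> Poly_Mapping.keys c"
    by (auto simp: in_keys_iff lookup_scaleR_poly_mapping)
  then show "chain_functional \<omega> (r *\<^sub>R c) = r *\<^sub>R chain_functional \<omega> c"
    by (simp add: chain_functional_superset[of "Poly_Mapping.keys c"] lookup_scaleR_poly_mapping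
        sum_distrib_left mult.assoc)
qed

lemma chain_functional_single: "chain_functional \<omega> (Poly_Mapping.single \<sigma> r) = r * \<omega> \<sigma>"
  by (cases "r = 0") (simp_all add: chain_functional_def)

definition edge_point :: "real \<Rightarrow> nat \<Rightarrow> real" where
  "edge_point t = (\<lambda>i. if i = 0 then 1 - t else if i = 1 then t else 0)"

text \<open>
  The cocycle of a map \<open>g\<close> into the punctured plane: the total change of the argument of \<open>g\<close>, in
  turns, along the edge of a singular 1-simplex.  Taking the winding number about 0, which also makes
  sense for paths that are not closed, avoids choosing lifts.
\<close>

definition circle_change :: "('a \<Rightarrow> complex) \<Rightarrow> ((nat \<Rightarrow> real) \<Rightarrow> 'a) \<Rightarrow> real" where
  "circle_change g \<sigma> = Re (winding_number (\<lambda>t. g (\<sigma> (edge_point t))) 0)"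

lemma continuous_map_into_standard_simplex:
  assumes "\<And>i. continuous_on S (\<lambda>x. h x i)" "h ` S \<subseteq> standard_simplex n"
  shows "continuous_map (top_of_set S) (subtopology (powertop_real UNIV) (standard_simplex n)) h"
  using assms by (simp add: continuous_map_in_subtopology continuous_map_componentwise_UNIV image_subset_iff_funcset)

text \<open>
  The standard 2-simplex lives in a function space without a norm; logarithms are constructed on its
  copy in the plane, which this map parametrizes by two of the three barycentric coordinates.
\<close>

definition triangle_point :: "real \<times> real \<Rightarrow> nat \<Rightarrow> real" where
  "triangle_point = (\<lambda>(s, t) i. if i = 0 then 1 - s - t else if i = 1 then s else if i = 2 then t else 0)"

definition triangle :: "(real \<times> real) set" where
  "triangle = {(s, t). 0 \<le> s \<and> 0 \<le> t \<and> s + t \<le> 1}"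

lemma triangle_point_in_simplex: "triangle_point ` triangle \<subseteq> standard_simplex 2"
  by (auto simp: triangle_def triangle_point_def standard_simplex_def eval_nat_numeral)

lemma edge_point_in_simplex: "t \<in> {0..1} \<Longrightarrow> edge_point t \<in> standard_simplex (Suc 0)"
  by (auto simp: edge_point_def standard_simplex_def)

text \<open>
  The cocycle condition.  The triangle is contractible, so \<open>g\<close> has a logarithm \<open>h\<close> over a whole
  singular 2-simplex, and the changes of \<open>h\<close> along the three sides cancel.
\<close>

lemma circle_change_boundary_2:
  fixes g :: "'a::topological_space \<Rightarrow> complex"
  assumes g: "continuous_on UNIV g" "\<And>x. g x \<noteq> 0"
    and \<sigma>: "singular_simplex 2 euclidean \<sigma>"
  shows "(\<Sum>k\<le>2. (-1) ^ k * circle_change g (singular_face 2 k \<sigma>)) = 0"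
proof -
  have cont_tp: "continuous_map (top_of_set triangle) (subtopology (powertop_real UNIV) (standard_simplex 2)) triangle_point"
  proof (rule continuous_map_into_standard_simplex)
    show "continuous_on triangle (\<lambda>x. triangle_point x i)" for i
    proof -
      have "continuous_on triangle (\<lambda>x. 1 - fst x - snd x)" "continuous_on triangle (fst :: real \<times> real \<Rightarrow> real)"
        "continuous_on triangle (snd :: real \<times> real \<Rightarrow> real)"
        by (intro continuous_intros)+
      then show ?thesis
        by (cases "i = 0"; cases "i = 1"; cases "i = 2") (simp_all add: triangle_point_def split_def)
    qed
  qed (rule triangle_point_in_simplex)
  have "continuous_map (top_of_set triangle) euclidean (\<sigma> \<circ> triangle_point)"
    using continuous_map_compose[OF cont_tp] \<sigma> unfolding singular_simplex_def by blast
  then have cs: "continuous_on triangle (\<sigma> \<circ> triangle_point)" by simp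
  have cg: "continuous_on triangle (\<lambda>x. g (\<sigma> (triangle_point x)))"
    using continuous_on_compose2[OF g(1) cs] by (simp add: comp_def)
  have "convex triangle"
  proof -
    have "triangle = {x. (1, 0) \<bullet> x \<ge> 0} \<inter> {x. (0, 1) \<bullet> x \<ge> 0} \<inter> {x. (1, 1) \<bullet> x \<le> (1::real)}"
      by (auto simp: triangle_def)
    then show ?thesis
      by (elim ssubst) (intro convex_Int convex_halfspace_ge convex_halfspace_le)
  qed
  then obtain h where h: "continuous_on triangle h"
    "\<And>x. x \<in> triangle \<Longrightarrow> g (\<sigma> (triangle_point x)) = exp (h x)"
    using continuous_logarithm_on_contractible[OF cg convex_imp_contractible] g(2) by blast
  \<comment> \<open>the three sides of the triangle, numbered by the opposite vertex\<close>
  define e :: "nat \<Rightarrow> real \<Rightarrow> real \<times> real" where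
    "e k t = (if k = 0 then (1 - t, t) else if k = 1 then (0, t) else (t, 0))" for k t
  have eT: "e k t \<in> triangle" if "t \<in> {0..1}" for k t
    using that by (auto simp: e_def triangle_def)
  have face: "singular_face 2 k \<sigma> (edge_point t) = \<sigma> (triangle_point (e k t))"
    if "k \<le> 2" "t \<in> {0..1}" for k t
  proof -
    have "simplical_face k (edge_point t) = triangle_point (e k t)"
      using that(1) by (auto simp: simplical_face_def edge_point_def triangle_point_def e_def fun_eq_iff)
    then show ?thesis
      using edge_point_in_simplex[OF that(2)] by (simp add: singular_face_def)
  qed
  have *: "circle_change g (singular_face 2 k \<sigma>) = Re ((h (e k 1) - h (e k 0)) / (2 * of_real pi * \<i>))"
    if k: "k \<le> 2" for k
  proof -
    have ce: "continuous_on {0..1} (e k)"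
    proof -
      have "continuous_on {0..1::real} (\<lambda>t. (1 - t, t))" "continuous_on {0..1::real} (\<lambda>t. (0::real, t))"
        "continuous_on {0..1::real} (\<lambda>t. (t, 0::real))"
        by (intro continuous_intros)+
      then show ?thesis by (cases "k = 0"; cases "k = 1") (simp_all add: e_def)
    qed
    have path: "path (h \<circ> e k)"
      unfolding path_def
      by (rule continuous_on_compose[OF ce continuous_on_subset[OF h(1)]]) (use eT in auto)
    have "winding_number (\<lambda>t. g (singular_face 2 k \<sigma> (edge_point t))) 0 = winding_number (exp \<circ> (h \<circ> e k)) 0"
      by (rule winding_number_cong) (use face[OF k] h(2) eT in \<open>auto simp: \<close>)
    then show ?thesis
      using winding_number_compose_exp[OF path]
      by (simp add: circle_change_def pathstart_def pathfinish_def)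
  qed
  have "{..2::nat} = {0, 1, 2}" by auto
  then show ?thesis
    by (simp add: * e_def) (simp add: Re_divide algebra_simps diff_divide_distrib)
qed

lemma chain_functional_boundary_2:
  fixes g :: "'a::topological_space \<Rightarrow> complex"
  assumes g: "continuous_on UNIV g" "\<And>x. g x \<noteq> 0" and c: "c \<in> real_boundaries 1 euclidean"
  shows "chain_functional (circle_change g) c = 0"
proof -
  interpret linear "chain_functional (circle_change g)" by (rule linear_chain_functional)
  obtain d where d: "c = real_chain_boundary 2 d" "Poly_Mapping.keys d \<subseteq> singular_simplex_set 2 euclidean"
    using c by (auto simp: real_boundaries_def real_singular_chains_def numeral_2_eq_2)
  have "chain_functional (circle_change g) c
      = (\<Sum>\<sigma>\<in>Poly_Mapping.keys d. \<Sum>k\<le>2.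
           ((-1) ^ k * Poly_Mapping.lookup d \<sigma>) * circle_change g (singular_face 2 k \<sigma>))"
    unfolding d(1) real_chain_boundary_def by (simp add: sum chain_functional_single)
  also have "\<dots> = (\<Sum>\<sigma>\<in>Poly_Mapping.keys d. Poly_Mapping.lookup d \<sigma> *
           (\<Sum>k\<le>2. (-1) ^ k * circle_change g (singular_face 2 k \<sigma>)))"
    by (simp add: sum_distrib_left mult.assoc mult.left_commute)
  also have "\<dots> = 0"
    using circle_change_boundary_2[OF g] d(2) by (intro sum.neutral) auto
  finally show ?thesis .
qed

text \<open>
  On the standard 1-simplex the coordinate with index 1 runs from 0 at the initial vertex to 1 at the
  final vertex.
\<close>

definition path_simplex :: "(real \<Rightarrow> 'a) \<Rightarrow> (nat \<Rightarrow> real) \<Rightarrow> 'a" where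
  "path_simplex \<gamma> = restrict (\<lambda>x. \<gamma> (x 1)) (standard_simplex 1)"

lemma circle_change_path_simplex:
  "circle_change g (path_simplex \<gamma>) = Re (winding_number (g \<circ> \<gamma>) 0)"
proof -
  have "winding_number (\<lambda>t. g (path_simplex \<gamma> (edge_point t))) 0 = winding_number (g \<circ> \<gamma>) 0"
  proof (rule winding_number_cong)
    fix t :: real assume "0 \<le> t" "t \<le> 1"
    then have "edge_point t \<in> standard_simplex (Suc 0)" by (simp add: edge_point_in_simplex)
    then show "g (path_simplex \<gamma> (edge_point t)) = (g \<circ> \<gamma>) t"
      by (simp add: path_simplex_def edge_point_def)
  qed
  then show ?thesis by (simp add: circle_change_def)
qed

lemma loop_is_real_cycle:
  fixes \<gamma> :: "real \<Rightarrow> 'a::topological_space"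
  assumes \<gamma>: "path \<gamma>" "pathfinish \<gamma> = pathstart \<gamma>"
  shows "Poly_Mapping.single (path_simplex \<gamma>) 1 \<in> real_cycles 1 euclidean"
proof -
  have cont1: "continuous_map (subtopology (powertop_real UNIV) (standard_simplex 1)) (top_of_set {0..1}) (\<lambda>x. x 1)"
    by (auto simp: continuous_map_in_subtopology standard_simplex_def
        intro!: continuous_map_from_subtopology continuous_map_product_projection)
  have "continuous_map (top_of_set {0..1}) euclidean \<gamma>" using \<gamma>(1) by (simp add: path_def)
  then have "continuous_map (subtopology (powertop_real UNIV) (standard_simplex 1)) euclidean (\<lambda>x. \<gamma> (x 1))"
    using continuous_map_compose[OF cont1, of euclidean \<gamma>] by (simp add: comp_def)
  then have "singular_simplex 1 euclidean (path_simplex \<gamma>)"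
    unfolding singular_simplex_def path_simplex_def
    by (auto intro: continuous_map_eq)
  moreover have "singular_face 1 0 (path_simplex \<gamma>) = singular_face 1 1 (path_simplex \<gamma>)"
  proof (rule ext)
    fix x :: "nat \<Rightarrow> real"
    show "singular_face 1 0 (path_simplex \<gamma>) x = singular_face 1 1 (path_simplex \<gamma>) x"
    proof (cases "x \<in> standard_simplex 0")
      case True
      then have "simplical_face 0 x \<in> standard_simplex 1" "simplical_face 1 x \<in> standard_simplex 1" "x 0 = 1"
        using simplical_face_in_standard_simplex[of 1 _ x] by (auto simp: standard_simplex_def)
      then show ?thesis
        using \<gamma>(2) True
        by (simp add: singular_face_def path_simplex_def simplical_face_def pathfinish_def pathstart_def)
    qed (simp add: singular_face_def)
  qed
  then have "real_chain_boundary 1 (Poly_Mapping.single (path_simplex \<gamma>) 1) = 0"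
    by (simp add: real_chain_boundary_def flip: single_add)
  ultimately show ?thesis
    by (simp add: real_cycles_def real_singular_chains_def)
qed

lemma winding_number_of_lift:
  fixes \<gamma> :: "real \<Rightarrow> 'a::topological_space" and u :: "'a \<Rightarrow> real"
  assumes "path \<gamma>" "path_image \<gamma> \<subseteq> T" "continuous_on T u"
    and "\<And>x. x \<in> T \<Longrightarrow> g x = exp (2 * of_real pi * \<i> * of_real (u x))"
  shows "Re (winding_number (g \<circ> \<gamma>) 0) = u (pathfinish \<gamma>) - u (pathstart \<gamma>)"
proof -
  let ?q = "\<lambda>t. 2 * of_real pi * \<i> * of_real (u (\<gamma> t))"
  have "continuous_on {0..1} (\<lambda>t. u (\<gamma> t))"
    using continuous_on_compose2[OF assms(3)] assms(1,2) by (simp add: path_def path_image_def)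
  then have q: "path ?q" unfolding path_def by (intro continuous_intros)
  have "winding_number (g \<circ> \<gamma>) 0 = winding_number (exp \<circ> ?q) 0"
  proof (rule winding_number_cong)
    fix t :: real assume "0 \<le> t" "t \<le> 1"
    then have "\<gamma> t \<in> T" using assms(2) by (auto simp: path_image_def)
    then show "(g \<circ> \<gamma>) t = (exp \<circ> ?q) t" using assms(4) by simp
  qed
  then show ?thesis
    using winding_number_compose_exp[OF q]
    by (simp add: pathstart_def pathfinish_def flip: right_diff_distrib of_real_diff)
qed

section \<open>Components of strips in a pointed geodesic space\<close>

text \<open>
  A function on a component \<open>E\<close> of an open set \<open>S\<close> may be continued by the constant \<open>k\<close> if its formula
  gives \<open>k\<close> off \<open>S\<close>, since the boundary of \<open>E\<close> lies there.  All circle-valued maps and their partial lifts below arise in this way.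
\<close>

lemma continuous_on_component_extend:
  fixes \<phi> :: "'a::topological_space \<Rightarrow> 'b::topological_space"
  assumes "open E" "open (S - E)" "continuous_on T \<phi>" "\<And>x. x \<in> T - S \<Longrightarrow> \<phi> x = k" "E \<subseteq> S"
  shows "continuous_on T (\<lambda>x. if x \<in> E then \<phi> x else k)"
proof -
  let ?A = "T \<inter> - (S - E)" and ?B = "T \<inter> - E"
  have T: "T = ?A \<union> ?B" by blast
  have "continuous_on (?A \<union> ?B) (\<lambda>x. if x \<in> E then \<phi> x else k)"
  proof (rule continuous_on_cases_local)
    show "closedin (top_of_set (?A \<union> ?B)) ?A" "closedin (top_of_set (?A \<union> ?B)) ?B"
      unfolding T[symmetric] by (rule closedin_closed_Int closed_Compl assms)+
    show "continuous_on ?A \<phi>" using assms(3) continuous_on_subset by blast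
    show "\<And>x. x \<in> ?A \<and> x \<notin> E \<or> x \<in> ?B \<and> x \<in> E \<Longrightarrow> \<phi> x = k"
      using assms(4) by blast
  qed auto
  then show ?thesis by (simp only: T[symmetric])
qed

lemma path_length_ge_sum:
  assumes "mono_on {..n} t" "t ` {..n} \<subseteq> {0..1}"
  shows "ennreal (\<Sum>i<n. dist (g (t i)) (g (t (Suc i)))) \<le> path_length g"
proof -
  have "ennreal (\<Sum>i<n. dist (g (t i)) (g (t (Suc i)))) = (\<Sum>i<n. ennreal (dist (g (t i)) (g (t (Suc i)))))"
    by (simp add: sum_ennreal)
  also have "\<dots> \<le> path_length g"
    unfolding path_length_def
    by (rule SUP_upper2[of "(n, t)"]) (use assms in auto)
  finally show ?thesis .
qed

locale pointed_geodesic_space =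
  fixes p :: "'a::metric_space" and f :: "'a \<Rightarrow> real"
  assumes geodesic: "geodesic_space (UNIV :: 'a set)"
    and f_eq: "\<And>x. f x = dist p x"
begin

lemma f_Lipschitz: "\<bar>f x - f y\<bar> \<le> dist x y"
  unfolding f_eq by (metis abs_dist_diff_le dist_commute)

lemma f_nonneg [simp]: "0 \<le> f x" by (simp add: f_eq)

lemma continuous_f: "continuous_on S f"
  unfolding f_eq by (intro continuous_intros)

lemma f_p [simp]: "f p = 0" by (simp add: f_eq)

lemma geodesic_path:
  fixes x y :: 'a
  obtains g where "path g" "pathstart g = x" "pathfinish g = y"
    "path_length g = ennreal (dist x y)"
    "\<And>s t. \<lbrakk>0 \<le> s; s \<le> t; t \<le> 1\<rbrakk> \<Longrightarrow> dist x (g s) + dist (g s) (g t) + dist (g t) y \<le> dist x y"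
proof -
  obtain g where g: "path g" "pathstart g = x" "pathfinish g = y" "path_length g = ennreal (dist x y)"
    using geodesic unfolding geodesic_space_def by blast
  have "dist x (g s) + dist (g s) (g t) + dist (g t) y \<le> dist x y"
    if st: "0 \<le> s" "s \<le> t" "t \<le> 1" for s t
  proof -
    let ?\<tau> = "\<lambda>i::nat. if i = 0 then 0 else if i = 1 then s else if i = 2 then t else 1"
    have "mono_on {..3} ?\<tau>" using st by (auto intro!: mono_onI)
    moreover have "?\<tau> ` {..3} \<subseteq> {0..1}" using st by auto
    ultimately have "ennreal (\<Sum>i<3. dist (g (?\<tau> i)) (g (?\<tau> (Suc i)))) \<le> path_length g"
      by (rule path_length_ge_sum)
    moreover have "(\<Sum>i<3. dist (g (?\<tau> i)) (g (?\<tau> (Suc i)))) = dist x (g s) + dist (g s) (g t) + dist (g t) y"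
      using g(2,3) by (simp add: eval_nat_numeral pathstart_def pathfinish_def)
    ultimately show ?thesis using g(4) by (simp add: ennreal_le_iff)
  qed
  then show ?thesis using that g by blast
qed

text \<open>
  A geodesic from the centre of a ball to one of its points stays in the ball.  Hence components of open sets are open
  and path connected, and the curves required for singular cycles exist although \<open>X\<close> may be wild.
\<close>

lemma locally_path_connected_UNIV: "locally path_connected (UNIV :: 'a set)"
proof (rule locally_path_connected_1)
  fix v and x :: 'a assume "openin (top_of_set UNIV) v" "x \<in> v"
  then obtain e where e: "e > 0" "ball x e \<subseteq> v" by (auto simp: open_contains_ball)
  have "path_component (ball x e) x y" if y: "y \<in> ball x e" for y
  proof -
    obtain g where g: "path g" "pathstart g = x" "pathfinish g = y"
      "\<And>s t. \<lbrakk>0 \<le> s; s \<le> t; t \<le> 1\<rbrakk> \<Longrightarrow> dist x (g s) + dist (g s) (g t) + dist (g t) y \<le> dist x y"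
      by (rule geodesic_path[of x y]) blast
    have "dist x (g t) < e" if "t \<in> {0..1}" for t
    proof -
      have "dist x (g t) + 0 + dist (g t) y \<le> dist x y"
        using g(4)[of t t] that by simp
      then show ?thesis using y zero_le_dist[of "g t" y] by (simp only: mem_ball)
    qed
    then have "path_image g \<subseteq> ball x e" by (auto simp: path_image_def)
    then show ?thesis using g(1-3) unfolding path_component_def by blast
  qed
  then have "path_connected (ball x e)"
    by (metis (no_types, lifting) path_component_sym path_component_trans path_connected_component)
  then show "\<exists>u. openin (top_of_set UNIV) u \<and> path_connected u \<and> x \<in> u \<and> u \<subseteq> v"
    using e by (intro exI[of _ "ball x e"]) auto
qed

lemma locally_path_connected_open: "open (S :: 'a set) \<Longrightarrow> locally path_connected S"
  using locally_open_subset[OF locally_path_connected_UNIV, of S] by simp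

lemma open_component:
  assumes "open (S :: 'a set)"
  shows "open (connected_component_set S x)"
proof -
  have "openin (top_of_set S) (path_component_set S x)"
    by (rule openin_path_component_locally_path_connected[OF locally_path_connected_open[OF assms]])
  then show ?thesis
    using assms path_component_eq_connected_component_set[OF locally_path_connected_open[OF assms]]
    by (metis openin_open_trans)
qed

lemma open_diff_component:
  assumes "open (S :: 'a set)"
  shows "open (S - connected_component_set S x)"
proof -
  have "S - connected_component_set S x = (\<Union>y \<in> S - connected_component_set S x. connected_component_set S y)"
    (is "?L = ?R")
  proof
    show "?L \<subseteq> ?R" by (auto intro: connected_component_refl)
    show "?R \<subseteq> ?L"
      using connected_component_in connected_component_sym connected_component_trans
      by (smt (verit) Diff_iff UN_iff mem_Collect_eq subsetI)
  qed
  then show ?thesis using open_component[OF assms] by (metis open_UN)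
qed

lemma connected_component_path:
  assumes "open (S :: 'a set)" "connected_component S x y"
  obtains g where "path g" "path_image g \<subseteq> S" "pathstart g = x" "pathfinish g = y"
proof -
  have "path_component S x y"
    using path_component_eq_connected_component[OF locally_path_connected_open[OF assms(1)]] assms(2) by simp
  then show ?thesis using that unfolding path_component_def by blast
qed

definition strip :: "real \<Rightarrow> real \<Rightarrow> 'a set" where
  "strip a b = {x. a < f x \<and> f x < b}"

abbreviation strip_component :: "real \<Rightarrow> real \<Rightarrow> 'a \<Rightarrow> 'a set" where
  "strip_component a b x \<equiv> connected_component_set (strip a b) x"

lemma open_strip [simp, intro]: "open (strip a b)"
proof -
  have "strip a b = f -` {a<..<b}" by (auto simp: strip_def)
  then show ?thesis
    using open_vimage[OF _ continuous_f] by (metis open_greaterThanLessThan)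
qed

text \<open>
  Along a geodesic issuing from \<open>p\<close> the function \<open>f\<close> is the arc length.  In particular moving down to a
  lower level costs exactly the drop in height.
\<close>

lemma radial_path:
  obtains g where "path g" "pathstart g = p" "pathfinish g = z"
    "\<And>s t. \<lbrakk>0 \<le> s; s \<le> t; t \<le> 1\<rbrakk> \<Longrightarrow> f (g s) \<le> f (g t)"
    "\<And>t. \<lbrakk>0 \<le> t; t \<le> 1\<rbrakk> \<Longrightarrow> dist z (g t) = f z - f (g t)"
proof -
  obtain g where g: "path g" "pathstart g = p" "pathfinish g = z"
    "\<And>s t. \<lbrakk>0 \<le> s; s \<le> t; t \<le> 1\<rbrakk> \<Longrightarrow> dist p (g s) + dist (g s) (g t) + dist (g t) z \<le> dist p z"
    by (rule geodesic_path[of p z]) blast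
  have d: "dist z (g t) = f z - f (g t)" if "0 \<le> t" "t \<le> 1" for t
    using g(4)[of t t] that dist_triangle[of p z "g t"] by (simp add: f_eq dist_commute)
  have "f (g s) \<le> f (g t)" if "0 \<le> s" "s \<le> t" "t \<le> 1" for s t
    using g(4)[OF that] d[of t] that zero_le_dist[of "g s" "g t"] unfolding f_eq
    by (smt (verit) dist_commute)
  with d g(1-3) that show ?thesis by blast
qed

lemma descend:
  assumes "0 \<le> r" "r \<le> f z"
  obtains w where "f w = r" "dist z w = f z - r" "connected_component {x. r \<le> f x \<and> f x \<le> f z} z w"
proof -
  obtain g where g: "path g" "pathstart g = p" "pathfinish g = z"
    "\<And>s t. \<lbrakk>0 \<le> s; s \<le> t; t \<le> 1\<rbrakk> \<Longrightarrow> f (g s) \<le> f (g t)"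
    "\<And>t. \<lbrakk>0 \<le> t; t \<le> 1\<rbrakk> \<Longrightarrow> dist z (g t) = f z - f (g t)"
    by (rule radial_path[of z]) blast
  have cg: "continuous_on {0..1} g" using g(1) by (simp add: path_def)
  have cfg: "continuous_on {0..1} (\<lambda>t. f (g t))"
    using continuous_on_compose[OF cg continuous_f] by (simp add: comp_def)
  have "\<exists>t\<ge>0. t \<le> 1 \<and> f (g t) = r"
    by (rule IVT') (use g(2,3) assms cfg in \<open>auto simp: pathstart_def pathfinish_def\<close>)
  then obtain t where t: "0 \<le> t" "t \<le> 1" "f (g t) = r" by blast
  have "connected (g ` {t..1})"
    using t by (intro connected_continuous_image continuous_on_subset[OF cg]) auto
  moreover have "g ` {t..1} \<subseteq> {x. r \<le> f x \<and> f x \<le> f z}"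
    using t g(4)[of t] g(4)[of _ 1] g(3) by (auto simp: pathfinish_def)
  moreover have "z \<in> g ` {t..1}" using g(3) t by (force simp: pathfinish_def)
  moreover have "g t \<in> g ` {t..1}" using t by auto
  ultimately have "connected_component {x. r \<le> f x \<and> f x \<le> f z} z (g t)"
    unfolding connected_component_def by blast
  with that t g(5) show ?thesis by simp
qed

text \<open>
  The cocycle dual to a component \<open>E\<close> of a strip: the map winds once around the circle when \<open>E\<close> is
  crossed from the bottom to the top, and is constant elsewhere.
\<close>

definition strip_circle_map :: "real \<Rightarrow> real \<Rightarrow> 'a set \<Rightarrow> 'a \<Rightarrow> complex" where
  "strip_circle_map a b E x =
     (if x \<in> E then exp (2 * of_real pi * \<i> * of_real ((f x - a) / (b - a))) else 1)"

context
  fixes a b :: real and x0 :: 'a and E :: "'a set"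
  assumes ab: "a < b" and E: "E = strip_component a b x0"
begin

lemma component_subset_strip: "E \<subseteq> strip a b" unfolding E by (rule connected_component_subset)

lemma continuous_E_extend:
  assumes "continuous_on T \<phi>" "\<And>x. x \<in> T - strip a b \<Longrightarrow> \<phi> x = k"
  shows "continuous_on T (\<lambda>x. if x \<in> E then \<phi> x else k)"
  by (rule continuous_on_component_extend[where S = "strip a b"])
    (use assms open_component open_diff_component component_subset_strip in \<open>auto simp: E\<close>)

lemma strip_circle_map_nonzero: "strip_circle_map a b E x \<noteq> 0"
  by (simp add: strip_circle_map_def)

definition relative_height where "relative_height x = max 0 (min 1 ((f x - a) / (b - a)))"

lemma relative_height_simps:
  "x \<in> strip a b \<Longrightarrow> relative_height x = (f x - a) / (b - a)" "f x \<le> a \<Longrightarrow> relative_height x = 0" "b \<le> f x \<Longrightarrow> relative_height x = 1"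
  using ab by (auto simp: relative_height_def strip_def field_simps max_def min_def)

lemma continuous_relative_height: "continuous_on T relative_height"
  unfolding relative_height_def using ab by (intro continuous_intros continuous_f) auto

lemma continuous_strip_circle_map: "continuous_on UNIV (strip_circle_map a b E)"
proof -
  have "continuous_on UNIV (\<lambda>x. if x \<in> E then exp (2 * of_real pi * \<i> * of_real (relative_height x)) else 1)"
  proof (rule continuous_E_extend)
    show "continuous_on UNIV (\<lambda>x. exp (2 * of_real pi * \<i> * of_real (relative_height x)))"
      by (intro continuous_intros continuous_relative_height)
    show "exp (2 * of_real pi * \<i> * of_real (relative_height x)) = 1" if "x \<in> UNIV - strip a b" for x
    proof -
      have "f x \<le> a \<or> b \<le> f x" using that by (auto simp: strip_def)
      then show ?thesis by (auto simp: relative_height_simps)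
    qed
  qed
  moreover have eq: "(\<lambda>x. if x \<in> E then exp (2 * of_real pi * \<i> * of_real (relative_height x)) else 1) = strip_circle_map a b E"
    using component_subset_strip by (auto simp: strip_circle_map_def relative_height_simps fun_eq_iff)
  ultimately show ?thesis by (simp only: eq)
qed

text \<open>
  Below the top of the strip the circle map lifts to the real line, with value 0 outside \<open>E\<close>; above its
  bottom it lifts with value 1 outside \<open>E\<close>.  The two lifts differ by 1 exactly off \<open>E\<close>, and this
  discrepancy is what makes a loop through \<open>E\<close> wind.
\<close>

lemma winding_below:
  assumes \<gamma>: "path \<gamma>" "\<And>x. x \<in> path_image \<gamma> \<Longrightarrow> f x < b"
  shows "Re (winding_number (strip_circle_map a b E \<circ> \<gamma>) 0)
    = (if pathfinish \<gamma> \<in> E then relative_height (pathfinish \<gamma>) else 0) - (if pathstart \<gamma> \<in> E then relative_height (pathstart \<gamma>) else 0)"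
proof (rule winding_number_of_lift[OF \<gamma>(1), where T = "{x. f x < b}"])
  show "continuous_on {x. f x < b} (\<lambda>x. if x \<in> E then relative_height x else 0)"
    by (rule continuous_E_extend) (auto simp: continuous_relative_height relative_height_simps strip_def)
qed (use \<gamma> component_subset_strip in \<open>auto simp: strip_circle_map_def relative_height_simps\<close>)

lemma winding_above:
  assumes \<gamma>: "path \<gamma>" "\<And>x. x \<in> path_image \<gamma> \<Longrightarrow> a < f x"
  shows "Re (winding_number (strip_circle_map a b E \<circ> \<gamma>) 0)
    = (if pathfinish \<gamma> \<in> E then relative_height (pathfinish \<gamma>) else 1) - (if pathstart \<gamma> \<in> E then relative_height (pathstart \<gamma>) else 1)"
proof (rule winding_number_of_lift[OF \<gamma>(1), where T = "{x. a < f x}"])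
  show "continuous_on {x. a < f x} (\<lambda>x. if x \<in> E then relative_height x else 1)"
    by (rule continuous_E_extend) (auto simp: continuous_relative_height relative_height_simps strip_def)
qed (use \<gamma> component_subset_strip in \<open>auto simp: strip_circle_map_def relative_height_simps\<close>)

lemma winding_join_3:
  assumes "path \<alpha>" "path \<beta>" "path \<alpha>'" "pathfinish \<alpha> = pathstart \<beta>" "pathfinish \<beta> = pathfinish \<alpha>'"
  shows "Re (winding_number (strip_circle_map a b E \<circ> (\<alpha> +++ (\<beta> +++ reversepath \<alpha>'))) 0)
    = Re (winding_number (strip_circle_map a b E \<circ> \<alpha>) 0) + Re (winding_number (strip_circle_map a b E \<circ> \<beta>) 0)
      - Re (winding_number (strip_circle_map a b E \<circ> \<alpha>') 0)"
proof -
  let ?g = "strip_circle_map a b E"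
  have path: "path (?g \<circ> \<gamma>)" if "path \<gamma>" for \<gamma>
    using that continuous_strip_circle_map by (metis continuous_on_subset path_continuous_image subset_UNIV)
  have nz: "0 \<notin> path_image (?g \<circ> \<gamma>)" for \<gamma>
    using strip_circle_map_nonzero by (auto simp: path_image_def)
  have "?g \<circ> (\<alpha> +++ (\<beta> +++ reversepath \<alpha>')) = (?g \<circ> \<alpha>) +++ ((?g \<circ> \<beta>) +++ reversepath (?g \<circ> \<alpha>'))"
    by (simp add: path_compose_join path_compose_reversepath)
  moreover have "winding_number \<dots> 0 = winding_number (?g \<circ> \<alpha>) 0 + (winding_number (?g \<circ> \<beta>) 0 - winding_number (?g \<circ> \<alpha>') 0)"
    using assms path nz
    by (simp add: winding_number_join winding_number_reversepath pathfinish_compose pathstart_compose path_image_join)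
  ultimately show ?thesis by simp
qed

end

text \<open>
  The topological core.  The loop of index \<open>i\<close> runs from \<open>p\<close> along a geodesic up to \<open>z i\<close>, crosses
  to \<open>z' i\<close> without leaving the strip at its bottom, and returns to \<open>p\<close> along a geodesic.  It passes
  through the component of \<open>z i\<close> once on the way up and avoids it on the way down, so the circle map of that
  component winds exactly once along it.  The other components at the same height are not affected,
  and a component of a higher strip cannot be crossed completely by a loop that stays below the top
  of this strip.  The pairing of loops and circle maps is therefore triangular with respect to the
  height, and the loops are independent in homology.
\<close>

lemma independent_strip_components_card_le:
  fixes a b c :: "'i \<Rightarrow> real" and z z' :: "'i \<Rightarrow> 'a"
  assumes betti: "betti_number 1 (euclidean :: 'a topology) < \<infinity>"
    and I: "finite I"
    and ab: "\<And>i. i \<in> I \<Longrightarrow> a i < b i" "\<And>i. i \<in> I \<Longrightarrow> b i \<le> c i"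
    and z: "\<And>i. i \<in> I \<Longrightarrow> z i \<in> strip (a i) (b i)" "\<And>i. i \<in> I \<Longrightarrow> z' i \<in> strip (a i) (b i)"
    and sep: "\<And>i. i \<in> I \<Longrightarrow> z' i \<notin> strip_component (a i) (b i) (z i)"
    and joined: "\<And>i. i \<in> I \<Longrightarrow> connected_component (strip (a i) (c i)) (z i) (z' i)"
    and same: "\<And>i j. \<lbrakk>i \<in> I; j \<in> I; i \<noteq> j; a i = a j\<rbrakk> \<Longrightarrow>
        b i = b j \<and> z i \<notin> strip_component (a j) (b j) (z j) \<and> z' i \<notin> strip_component (a j) (b j) (z j)"
    and above: "\<And>i j. \<lbrakk>i \<in> I; j \<in> I; a i < a j\<rbrakk> \<Longrightarrow> c i \<le> b j"
  shows "card I \<le> the_enat (betti_number 1 (euclidean :: 'a topology))"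
proof -
  obtain B where B: "finite B" "quotient_basis (real_cycles 1 (euclidean :: 'a topology)) (real_boundaries 1 euclidean) B"
    "betti_number 1 (euclidean :: 'a topology) = enat (card B)"
    using finite_betti_number_obtains_basis betti unfolding betti_number_def by metis
  have "\<exists>g. path g \<and> pathstart g = p \<and> pathfinish g = y \<and> (\<forall>x\<in>path_image g. f x \<le> f y)" for y
  proof -
    obtain g where g: "path g" "pathstart g = p" "pathfinish g = y"
      "\<And>s t. \<lbrakk>0 \<le> s; s \<le> t; t \<le> 1\<rbrakk> \<Longrightarrow> f (g s) \<le> f (g t)"
      by (rule radial_path[of y]) blast
    have "\<forall>x\<in>path_image g. f x \<le> f y"
      using g(3) g(4)[of _ 1] by (auto simp: path_image_def pathfinish_def)
    with g show ?thesis by blast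
  qed
  then obtain \<rho> where \<rho>: "\<And>y. path (\<rho> y)" "\<And>y. pathstart (\<rho> y) = p" "\<And>y. pathfinish (\<rho> y) = y"
    "\<And>x y. x \<in> path_image (\<rho> y) \<Longrightarrow> f x \<le> f y"
    by metis
  have "\<exists>g. path g \<and> path_image g \<subseteq> strip (a i) (c i) \<and> pathstart g = z i \<and> pathfinish g = z' i" if "i \<in> I" for i
    by (rule connected_component_path[OF _ joined[OF that]]) auto
  then obtain \<kappa> where \<kappa>: "\<And>i. i \<in> I \<Longrightarrow> path (\<kappa> i)" "\<And>i. i \<in> I \<Longrightarrow> path_image (\<kappa> i) \<subseteq> strip (a i) (c i)"
    "\<And>i. i \<in> I \<Longrightarrow> pathstart (\<kappa> i) = z i" "\<And>i. i \<in> I \<Longrightarrow> pathfinish (\<kappa> i) = z' i"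
    by metis
  define \<gamma> where "\<gamma> i = \<rho> (z i) +++ (\<kappa> i +++ reversepath (\<rho> (z' i)))" for i
  define E where "E i = strip_component (a i) (b i) (z i)" for i
  define g where "g i = strip_circle_map (a i) (b i) (E i)" for i
  have wind: "Re (winding_number (g j \<circ> \<gamma> i) 0) =
      Re (winding_number (g j \<circ> \<rho> (z i)) 0) + Re (winding_number (g j \<circ> \<kappa> i) 0) - Re (winding_number (g j \<circ> \<rho> (z' i)) 0)"
    if "i \<in> I" "j \<in> I" for i j
    unfolding g_def \<gamma>_def
    by (rule winding_join_3[OF ab(1) E_def]) (use that \<rho> \<kappa> in auto)
  \<comment> \<open>at equal heights the lift from below applies to both geodesics, the lift from above to the middle part\<close>
  have same_level: "Re (winding_number (g j \<circ> \<gamma> i) 0) = of_bool (z' i \<notin> E j) - of_bool (z i \<notin> E j)"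
    if ij: "i \<in> I" "j \<in> I" "a i = a j" "b i = b j" for i j
  proof -
    have 1: "Re (winding_number (g j \<circ> \<rho> y) 0) = (if y \<in> E j then relative_height (a j) (b j) y else 0) - (if p \<in> E j then relative_height (a j) (b j) p else 0)"
      if "f y < b i" for y
    proof -
      have "f x < b j" if "x \<in> path_image (\<rho> y)" for x
        using \<rho>(4)[OF that] \<open>f y < b i\<close> ij by linarith
      then show ?thesis
        unfolding g_def using winding_below[OF ab(1)[OF ij(2)] E_def \<rho>(1)[of y]] by (simp add: \<rho>)
    qed
    have 2: "Re (winding_number (g j \<circ> \<kappa> i) 0) = (if z' i \<in> E j then relative_height (a j) (b j) (z' i) else 1) - (if z i \<in> E j then relative_height (a j) (b j) (z i) else 1)"
      unfolding g_def using \<kappa>(2)[OF ij(1)] ij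
      by (subst winding_above[OF ab(1) E_def]) (auto simp: \<kappa> strip_def)
    show ?thesis
      using z(1)[OF ij(1)] z(2)[OF ij(1)] ij by (simp add: wind 1 2 strip_def)
  qed
  \<comment> \<open>here the whole loop stays below the top of the strip, where the circle map has a single-valued lift\<close>
  have higher_level: "Re (winding_number (g j \<circ> \<gamma> i) 0) = 0" if ij: "i \<in> I" "j \<in> I" "a i < a j" for i j
  proof -
    have cb: "c i \<le> b j" by (rule above[OF ij])
    have 1: "Re (winding_number (g j \<circ> \<rho> y) 0) = (if y \<in> E j then relative_height (a j) (b j) y else 0) - (if p \<in> E j then relative_height (a j) (b j) p else 0)"
      if "f y < b i" for y
    proof -
      have "f x < b j" if "x \<in> path_image (\<rho> y)" for x
        using \<rho>(4)[OF that] \<open>f y < b i\<close> cb ab(2)[OF ij(1)] by linarith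
      then show ?thesis
        unfolding g_def using winding_below[OF ab(1)[OF ij(2)] E_def \<rho>(1)[of y]] by (simp add: \<rho>)
    qed
    have 2: "Re (winding_number (g j \<circ> \<kappa> i) 0) = (if z' i \<in> E j then relative_height (a j) (b j) (z' i) else 0) - (if z i \<in> E j then relative_height (a j) (b j) (z i) else 0)"
      unfolding g_def using \<kappa>(2)[OF ij(1)] ij cb
      by (subst winding_below[OF ab(1) E_def]) (force simp: \<kappa> strip_def)+
    show ?thesis
      using z(1)[OF ij(1)] z(2)[OF ij(1)] ij by (simp add: wind 1 2 strip_def)
  qed
  have "card I \<le> card B"
  proof (rule quotient_basis_card_bound[OF B(1,2) I, where
        \<gamma> = "\<lambda>i. Poly_Mapping.single (path_simplex (\<gamma> i)) 1" and
        \<Phi> = "\<lambda>i. chain_functional (circle_change (g i))" and key = a])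
    fix i assume i: "i \<in> I"
    show "Poly_Mapping.single (path_simplex (\<gamma> i)) 1 \<in> real_cycles 1 euclidean"
      by (rule loop_is_real_cycle) (use \<rho> \<kappa> i in \<open>auto simp: \<gamma>_def\<close>)
    show "linear (chain_functional (circle_change (g i)))" by (rule linear_chain_functional)
    show "chain_functional (circle_change (g i)) w = 0" if "w \<in> real_boundaries 1 euclidean" for w
      by (rule chain_functional_boundary_2[OF _ _ that])
        (use continuous_strip_circle_map[OF ab(1)[OF i] E_def] strip_circle_map_nonzero[OF ab(1)[OF i] E_def]
          in \<open>auto simp: g_def\<close>)
    have "z i \<in> E i" using z(1)[OF i] by (simp add: E_def connected_component_refl_eq)
    then show "chain_functional (circle_change (g i)) (Poly_Mapping.single (path_simplex (\<gamma> i)) 1) = 1"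
      using same_level[OF i i] sep[OF i]
      by (simp add: chain_functional_single circle_change_path_simplex E_def)
  next
    fix i j assume ij: "i \<in> I" "j \<in> I" "i \<noteq> j" "a i \<le> a j"
    show "chain_functional (circle_change (g j)) (Poly_Mapping.single (path_simplex (\<gamma> i)) 1) = 0"
    proof (cases "a i = a j")
      case True
      then show ?thesis using same[OF ij(1-3)] same_level[OF ij(1,2)]
        by (simp add: chain_functional_single circle_change_path_simplex E_def)
    next
      case False
      then show ?thesis using higher_level[OF ij(1,2)] ij(4)
        by (simp add: chain_functional_single circle_change_path_simplex)
    qed
  qed
  then show ?thesis using B(3) by simp
qed

end

section \<open>Diameters of strip components and area\<close>

text \<open>
  A connected set close to finitely many connected sets \<open>F\<close> is no wider than the sum of the diameters
  of sets covering the \<open>F\<close>, plus \<open>2 \<rho>\<close> for every jump between different \<open>F\<close>.  One and the same set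
  \<open>U i\<close> may meet several \<open>F\<close> and must be charged only once.  This is why the proof grows a single
  subfamily \<open>K\<close> of the cover around \<open>x\<close> rather than estimating the \<open>F\<close> separately.  Here \<open>G K\<close> says that
  \<open>K\<close> has been reached by touching the members of some \<open>\<E>\<close>, hence with at most \<open>card \<E> - 1\<close> jumps.
\<close>

lemma dist_le_linked_cover:
  fixes w :: "'a::metric_space set" and U :: "'i \<Rightarrow> 'a set" and d :: "'i \<Rightarrow> real"
  assumes w: "connected w" "x \<in> w" "y \<in> w"
    and J: "finite J" "\<And>i. i \<in> J \<Longrightarrow> open (U i)" "\<And>i. i \<in> J \<Longrightarrow> 0 \<le> d i"
    and d: "\<And>i u v. \<lbrakk>i \<in> J; u \<in> U i; v \<in> U i\<rbrakk> \<Longrightarrow> dist u v \<le> d i"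
    and \<F>: "finite \<F>" "\<And>F. F \<in> \<F> \<Longrightarrow> connected F" "\<And>F. F \<in> \<F> \<Longrightarrow> F \<subseteq> (\<Union>i\<in>J. U i)"
    and near: "\<And>z. z \<in> w \<Longrightarrow> \<exists>F\<in>\<F>. \<exists>u\<in>F. dist z u < \<rho>"
  shows "dist x y \<le> sum d J + 2 * \<rho> * real (card \<F>)"
proof -
  obtain F0 u0 where F0: "F0 \<in> \<F>" "u0 \<in> F0" "dist x u0 < \<rho>" using near[OF w(2)] by blast
  obtain i0 where i0: "i0 \<in> J" "u0 \<in> U i0" using F0 \<F>(3) by blast
  have \<rho>: "\<rho> > 0" using F0(3) zero_le_dist[of x u0] by linarith
  define O' where "O' K = (\<Union>i\<in>K. U i)" for K
  define G where "G K \<longleftrightarrow> K \<subseteq> J \<and> i0 \<in> K \<and> (\<exists>\<E>. \<E> \<subseteq> \<F> \<and> \<E> \<noteq> {} \<and> (\<forall>F\<in>\<E>. F \<inter> O' K \<noteq> {}) \<and>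
      (\<forall>u\<in>O' K. dist x u \<le> \<rho> + sum d K + 2 * \<rho> * (real (card \<E>) - 1)))" for K
  have "G {i0}"
  proof -
    have "dist x u \<le> \<rho> + d i0" if "u \<in> U i0" for u
      using d[OF i0(1) i0(2) that] F0(3) dist_triangle[of x u u0] by linarith
    then show ?thesis
      unfolding G_def O'_def using i0 F0 by (intro conjI exI[of _ "{F0}"]) auto
  qed
  moreover have finG: "finite (Collect G)"
    by (rule finite_subset[of _ "Pow J"]) (auto simp: G_def J(1))
  ultimately obtain K where K: "G K" and Kmax: "\<And>K'. G K' \<Longrightarrow> K \<subseteq> K' \<Longrightarrow> K = K'"
    using finite_has_maximal[OF finG] by (metis empty_iff mem_Collect_eq)
  obtain \<E> where \<E>: "\<E> \<subseteq> \<F>" "\<E> \<noteq> {}" "\<And>F. F \<in> \<E> \<Longrightarrow> F \<inter> O' K \<noteq> {}"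
    "\<And>u. u \<in> O' K \<Longrightarrow> dist x u \<le> \<rho> + sum d K + 2 * \<rho> * (real (card \<E>) - 1)"
    using K unfolding G_def by blast
  have KJ: "K \<subseteq> J" "i0 \<in> K" using K by (auto simp: G_def)
  have finK: "finite K" using KJ(1) J(1) finite_subset by blast
  have fin\<E>: "finite \<E>" using \<E>(1) \<F>(1) finite_subset by blast
  \<comment> \<open>a further set meeting the reached region could be added without a jump\<close>
  have disj: "U i \<inter> O' K = {}" if i: "i \<in> J" "i \<notin> K" for i
  proof (rule ccontr)
    assume "U i \<inter> O' K \<noteq> {}"
    then obtain v where v: "v \<in> U i" "v \<in> O' K" by blast
    have "dist x u \<le> \<rho> + sum d (insert i K) + 2 * \<rho> * (real (card \<E>) - 1)" if "u \<in> O' (insert i K)" for u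
    proof (cases "u \<in> O' K")
      case True
      then show ?thesis using \<E>(4)[OF True] J(3)[OF i(1)] i(2) finK by simp
    next
      case False
      then have "u \<in> U i" using that by (auto simp: O'_def)
      then show ?thesis
        using \<E>(4)[OF v(2)] d[OF i(1) v(1), of u] dist_triangle[of x u v] i(2) finK by simp
    qed
    moreover have "F \<inter> O' (insert i K) \<noteq> {}" if "F \<in> \<E>" for F
      using \<E>(3)[OF that] by (auto simp: O'_def)
    ultimately have "G (insert i K)"
      unfolding G_def using KJ i(1) \<E>(1,2) by blast
    then show False using Kmax[of "insert i K"] i(2) by blast
  qed
  have openO: "open (O' L)" if "L \<subseteq> J" for L
    unfolding O'_def using that J(2) by blast
  have dich: "F \<subseteq> O' K \<or> F \<inter> O' K = {}" if F: "F \<in> \<F>" for F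
  proof -
    have "F \<subseteq> O' K \<union> O' (J - K)" using \<F>(3)[OF F] by (auto simp: O'_def)
    moreover have "O' K \<inter> O' (J - K) = {}" using disj by (auto simp: O'_def)
    ultimately have "O' K \<inter> F = {} \<or> O' (J - K) \<inter> F = {}"
      using connectedD[OF \<F>(2)[OF F] openO[OF KJ(1)] openO[of "J - K"]] by blast
    then show ?thesis using \<open>F \<subseteq> O' K \<union> O' (J - K)\<close> by blast
  qed
  define A where "A = (\<Union>F\<in>{F\<in>\<F>. F \<subseteq> O' K}. \<Union>u\<in>F. ball u \<rho>)"
  define B where "B = (\<Union>F\<in>{F\<in>\<F>. F \<inter> O' K = {}}. \<Union>u\<in>F. ball u \<rho>)"
  have "w \<subseteq> A \<union> B"
  proof
    fix z assume "z \<in> w"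
    then obtain F u where "F \<in> \<F>" "u \<in> F" "dist z u < \<rho>" using near by blast
    then show "z \<in> A \<union> B" using dich[of F] unfolding A_def B_def by (auto simp: dist_commute)
  qed
  \<comment> \<open>a point of \<open>w\<close> near both a reached and an unreached \<open>F\<close> would permit one more jump, towards an \<open>F\<close> not counted so far\<close>
  moreover have "A \<inter> B = {}"
  proof (rule ccontr)
    assume "A \<inter> B \<noteq> {}"
    then obtain z F u F' u' where F: "F \<in> \<F>" "F \<subseteq> O' K" "u \<in> F" "dist u z < \<rho>"
      and F': "F' \<in> \<F>" "F' \<inter> O' K = {}" "u' \<in> F'" "dist u' z < \<rho>"
      unfolding A_def B_def by auto
    obtain j where j: "j \<in> J" "u' \<in> U j" using F'(1,3) \<F>(3) by blast
    have jK: "j \<notin> K" using j F'(2,3) by (auto simp: O'_def)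
    have F'\<E>: "F' \<notin> \<E>" using \<E>(3) F'(2) by blast
    have "dist x v \<le> \<rho> + sum d (insert j K) + 2 * \<rho> * (real (card (insert F' \<E>)) - 1)"
      if "v \<in> O' (insert j K)" for v
    proof (cases "v \<in> O' K")
      case True
      then show ?thesis
        using \<E>(4)[OF True] J(3)[OF j(1)] jK finK F'\<E> fin\<E> \<rho> by (simp add: algebra_simps)
    next
      case False
      then have v: "v \<in> U j" using that by (auto simp: O'_def)
      have "dist x u \<le> \<rho> + sum d K + 2 * \<rho> * (real (card \<E>) - 1)" using \<E>(4) F(2,3) by blast
      moreover have "dist u u' \<le> 2 * \<rho>"
        using F(4) F'(4) dist_triangle[of u u' z] by (simp add: dist_commute)
      moreover have "dist u' v \<le> d j" by (rule d[OF j v])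
      ultimately have "dist x v \<le> \<rho> + sum d K + 2 * \<rho> * (real (card \<E>) - 1) + 2 * \<rho> + d j"
        using dist_triangle[of x v u'] dist_triangle[of x u' u] by linarith
      then show ?thesis using jK finK F'\<E> fin\<E> by (simp add: algebra_simps)
    qed
    moreover have "F \<inter> O' (insert j K) \<noteq> {}" if "F \<in> insert F' \<E>" for F
      using \<E>(3)[of F] that j(2) F'(3) by (auto simp: O'_def)
    ultimately have "G (insert j K)"
      unfolding G_def using KJ j(1) \<E>(1) F'(1)
      by (intro conjI exI[of _ "insert F' \<E>"]) auto
    then show False using Kmax[of "insert j K"] jK by blast
  qed
  moreover have "x \<in> A"
    using F0 i0 KJ(2) dich[OF F0(1)] unfolding A_def O'_def by (fastforce simp: dist_commute)
  moreover have "open A" "open B" unfolding A_def B_def by blast+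
  ultimately have "w \<subseteq> A" using connectedD[OF w(1), of A B] w(2) by blast
  then obtain F u where F: "F \<in> \<F>" "F \<subseteq> O' K" "u \<in> F" "dist u y < \<rho>"
    using w(3) unfolding A_def by auto
  have "dist x y \<le> sum d K + 2 * \<rho> * real (card \<E>)"
    using \<E>(4)[of u] F dist_triangle[of x y u] by (auto simp: algebra_simps)
  also have "\<dots> \<le> sum d J + 2 * \<rho> * real (card \<F>)"
    using \<rho> J KJ(1) \<E>(1) \<F>(1) by (intro add_mono sum_mono2 mult_left_mono) (auto simp: card_mono)
  finally show ?thesis .
qed

text \<open>
  A bound of the measure only requires covers at one scale, here 1, since the supremum over scales
  dominates.  The sets are replaced by open neighbourhoods so thin that the sum of squared diameters
  grows by at most \<open>\<kappa> / 2\<close>; the factor \<open>4 / pi\<close> comes from the weight \<open>pi * (diameter / 2)\<^sup>2\<close>.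
\<close>

lemma hausdorff_measure_2_finite_open_cover:
  fixes H \<kappa> :: real
  assumes "compact (UNIV :: 'a::metric_space set)"
    and H: "hausdorff_measure 2 (UNIV :: 'a set) = ennreal H" "0 \<le> H" and \<kappa>: "\<kappa> > 0"
  obtains I :: "nat set" and U :: "nat \<Rightarrow> 'a::metric_space set" and d :: "nat \<Rightarrow> real"
  where "finite I" "\<And>i. open (U i)" "(\<Union>i\<in>I. U i) = UNIV" "\<And>i. 0 \<le> d i"
    "\<And>i u v. \<lbrakk>u \<in> U i; v \<in> U i\<rbrakk> \<Longrightarrow> dist u v \<le> d i"
    "(\<Sum>i\<in>I. (d i)\<^sup>2) \<le> 4 / pi * H + \<kappa>"
proof -
  define \<kappa>' where "\<kappa>' = \<kappa> * pi / 8"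
  have \<kappa>': "\<kappa>' > 0" using \<kappa> by (simp add: \<kappa>'_def)
  let ?C = "{U :: nat \<Rightarrow> 'a set. UNIV \<subseteq> (\<Union>i. U i) \<and> (\<forall>i. bounded (U i) \<and> diameter (U i) \<le> 1)}"
  have "(INF U \<in> ?C. suminf (\<lambda>i. hausdorff_weight 2 (U i))) \<le> ennreal H"
    unfolding H(1)[symmetric] hausdorff_measure_def by (rule SUP_upper2[of 1]) auto
  also have "\<dots> < ennreal (H + \<kappa>')" using \<kappa>' H(2) by (simp add: ennreal_less_iff)
  finally obtain A :: "nat \<Rightarrow> 'a set" where A: "UNIV \<subseteq> (\<Union>i. A i)" "\<And>i. bounded (A i)"
    "suminf (\<lambda>i. hausdorff_weight 2 (A i)) < ennreal (H + \<kappa>')"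
    unfolding INF_less_iff by blast
  define a where "a i = diameter (A i)" for i
  have a0: "a i \<ge> 0" for i using diameter_ge_0[OF A(2)] by (simp add: a_def)
  have weight: "hausdorff_weight 2 (A i) = ennreal (pi / 4 * (a i)\<^sup>2)" for i
    using a0[of i] by (auto simp: hausdorff_weight_def a_def power_divide unit_ball_vol_2)
  have suma: "(\<Sum>i\<in>I. (a i)\<^sup>2) \<le> 4 / pi * H + \<kappa> / 2" if "finite I" for I
  proof -
    have "ennreal (\<Sum>i\<in>I. pi / 4 * (a i)\<^sup>2) = (\<Sum>i\<in>I. hausdorff_weight 2 (A i))"
      by (simp add: weight)
    also have "\<dots> \<le> suminf (\<lambda>i. hausdorff_weight 2 (A i))"
      by (rule sum_le_suminf) (use that in auto)
    finally have "ennreal (\<Sum>i\<in>I. pi / 4 * (a i)\<^sup>2) < ennreal (H + \<kappa>')" using A(3) by simp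
    then have "pi / 4 * (\<Sum>i\<in>I. (a i)\<^sup>2) < H + \<kappa>'"
      by (subst (asm) ennreal_less_iff) (auto simp: sum_nonneg sum_distrib_left)
    then show ?thesis by (simp add: \<kappa>'_def field_simps)
  qed
  \<comment> \<open>the enlarged diameters, chosen such that the squares increase by a geometric series\<close>
  define d where "d i = sqrt ((a i)\<^sup>2 + \<kappa> / 2 * (1 / 2) ^ Suc i)" for i
  define \<epsilon> where "\<epsilon> i = (d i - a i) / 2" for i
  have d0: "d i \<ge> 0" for i using \<kappa> by (simp add: d_def)
  have \<epsilon>: "\<epsilon> i > 0" for i
  proof -
    have "a i < d i" unfolding d_def by (rule real_less_rsqrt) (use \<kappa> in simp)
    then show ?thesis by (simp add: \<epsilon>_def)
  qed
  define U where "U i = (\<Union>x\<in>A i. ball x (\<epsilon> i))" for i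
  have "UNIV \<subseteq> (\<Union>i\<in>UNIV. U i)"
  proof
    fix x :: 'a
    obtain i where "x \<in> A i" using A(1) by blast
    then have "x \<in> U i" using \<epsilon>[of i] unfolding U_def by (intro UN_I[of x]) auto
    then show "x \<in> (\<Union>i\<in>UNIV. U i)" by blast
  qed
  moreover have openU: "open (U i)" for i unfolding U_def by blast
  ultimately obtain I where I: "finite I" "UNIV \<subseteq> (\<Union>i\<in>I. U i)"
    by (elim compactE_image[OF assms(1), of UNIV U, rotated]) auto
  have dist: "dist u v \<le> d i" if uv: "u \<in> U i" "v \<in> U i" for i u v
  proof -
    obtain s t where st: "s \<in> A i" "t \<in> A i" "dist s u < \<epsilon> i" "dist t v < \<epsilon> i"
      using uv unfolding U_def by auto
    have "dist s t \<le> a i" unfolding a_def using diameter_bounded_bound[OF A(2)] st by blast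
    then show ?thesis
      using st(3,4) dist_triangle[of u v s] dist_triangle[of s v t] by (simp add: \<epsilon>_def dist_commute)
  qed
  have "(\<Sum>i\<in>I. (d i)\<^sup>2) = (\<Sum>i\<in>I. (a i)\<^sup>2) + \<kappa> / 2 * (\<Sum>i\<in>I. (1 / 2) ^ Suc i)"
    using \<kappa> by (simp add: d_def sum.distrib sum_distrib_left)
  also have "(\<Sum>i\<in>I. (1 / 2 :: real) ^ Suc i) \<le> 1"
    using sum_le_suminf[OF sums_summable[OF power_half_series] I(1)] sums_unique[OF power_half_series] by simp
  finally have sum: "(\<Sum>i\<in>I. (d i)\<^sup>2) \<le> 4 / pi * H + \<kappa>"
    using suma[OF I(1)] \<kappa> by simp
  have UN: "(\<Union>i\<in>I. U i) = UNIV" using I(2) by blast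
  show ?thesis by (rule that[OF I(1) openU UN d0 dist sum])
qed

context pointed_geodesic_space
begin

text \<open>
  If \<open>K\<close> reached \<open>m\<close> components at the bottom of its strip, then joining one of them to each of the
  others through \<open>K\<close> would give \<open>m - 1\<close> independent loops.
\<close>

lemma strip_components_finite_card_le:
  assumes betti: "betti_number 1 (euclidean :: 'a topology) < \<infinity>"
    and K: "connected K" "K \<subseteq> strip r c" and rs: "r < s" "s \<le> c"
  shows "finite (strip_component r s ` (K \<inter> strip r s)) \<and>
    card (strip_component r s ` (K \<inter> strip r s)) \<le> Suc (the_enat (betti_number 1 (euclidean :: 'a topology)))"
proof (rule finite_if_finite_subsets_card_bdd)
  fix \<G> assume \<G>: "\<G> \<subseteq> strip_component r s ` (K \<inter> strip r s)" "finite \<G>"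
  show "card \<G> \<le> Suc (the_enat (betti_number 1 (euclidean :: 'a topology)))"
  proof (cases "\<G> = {}")
    case False
    then obtain F0 where F0: "F0 \<in> \<G>" by blast
    have "\<forall>F\<in>\<G>. \<exists>y. y \<in> K \<inter> strip r s \<and> F = strip_component r s y" using \<G>(1) by blast
    from bchoice[OF this] obtain \<zeta>
      where \<zeta>: "\<And>F. F \<in> \<G> \<Longrightarrow> \<zeta> F \<in> K \<inter> strip r s \<and> F = strip_component r s (\<zeta> F)"
      by blast
    have neq: "\<zeta> F \<notin> strip_component r s (\<zeta> F')" if "F \<in> \<G>" "F' \<in> \<G>" "F \<noteq> F'" for F F'
      using \<zeta>[OF that(1)] \<zeta>[OF that(2)] that(3) connected_component_eq[of "\<zeta> F" "strip r s" "\<zeta> F'"] by auto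
    have "card (\<G> - {F0}) \<le> the_enat (betti_number 1 (euclidean :: 'a topology))"
    proof (rule independent_strip_components_card_le[OF betti, where
          a = "\<lambda>_. r" and b = "\<lambda>_. s" and c = "\<lambda>_. c" and z = \<zeta> and z' = "\<lambda>_. \<zeta> F0"])
      fix F assume F: "F \<in> \<G> - {F0}"
      show "connected_component (strip r c) (\<zeta> F) (\<zeta> F0)"
        unfolding connected_component_def using K \<zeta>[of F] \<zeta>[of F0] F F0 by blast
    qed (use \<G>(2) rs \<zeta> F0 neq in auto)
    then show ?thesis using \<G>(2) F0 by simp
  qed simp
qed

text \<open>
  All points of a strip component descend to a thin strip at any lower height \<open>r\<close>, and the components
  of the thin strip reached in this way are at most \<open>b\<^sub>1 + 1\<close> in number.  Their neighbourhoods of radius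
  \<open>c + e - r\<close> cover the connected set that was started from, so they cannot all be small.
\<close>

lemma strip_component_dist_le_level_sum:
  fixes U :: "'i \<Rightarrow> 'a set" and d :: "'i \<Rightarrow> real"
  assumes betti: "betti_number 1 (euclidean :: 'a topology) < \<infinity>"
    and xy: "x \<in> strip (c - e) (c + e)" "y \<in> strip_component (c - e) (c + e) x"
    and r: "0 \<le> r" "r \<le> c - e" and \<eta>: "0 < \<eta>" "\<eta> \<le> 2 * e"
    and I: "finite I" "\<And>i. i \<in> I \<Longrightarrow> open (U i)" "(\<Union>i\<in>I. U i) = UNIV" "\<And>i. i \<in> I \<Longrightarrow> 0 \<le> d i"
      "\<And>i u v. \<lbrakk>i \<in> I; u \<in> U i; v \<in> U i\<rbrakk> \<Longrightarrow> dist u v \<le> d i"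
  shows "dist x y \<le> sum d {i\<in>I. U i \<inter> strip r (r + \<eta>) \<noteq> {}}
    + 2 * (c + e - r) * real (Suc (the_enat (betti_number 1 (euclidean :: 'a topology))))"
proof -
  let ?W = "strip_component (c - e) (c + e) x" and ?K = "strip_component r (c + e) x"
  let ?\<F> = "strip_component r (r + \<eta>) ` (?K \<inter> strip r (r + \<eta>))"
  have "?W \<subseteq> strip r (c + e)"
    using connected_component_subset[of "strip (c - e) (c + e)" x] r(2) by (auto simp: strip_def)
  then have WK: "?W \<subseteq> ?K"
    using xy(1) by (intro connected_component_maximal) auto
  have \<F>: "finite ?\<F>" "card ?\<F> \<le> Suc (the_enat (betti_number 1 (euclidean :: 'a topology)))"
    using strip_components_finite_card_le[OF betti, of ?K r "c + e" "r + \<eta>"] r \<eta>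
    by (auto intro: connected_component_subset[THEN subsetD])
  have "dist x y \<le> sum d {i\<in>I. U i \<inter> strip r (r + \<eta>) \<noteq> {}} + 2 * (c + e - r) * real (card ?\<F>)"
  proof (rule dist_le_linked_cover[of ?W])
    show "connected ?W" "x \<in> ?W" "y \<in> ?W" using xy by auto
    show "\<And>F. F \<in> ?\<F> \<Longrightarrow> connected F" by auto
    show "F \<subseteq> (\<Union>i\<in>{i\<in>I. U i \<inter> strip r (r + \<eta>) \<noteq> {}}. U i)" if "F \<in> ?\<F>" for F
    proof
      fix u assume "u \<in> F"
      then have "u \<in> strip r (r + \<eta>)" using that connected_component_subset by blast
      moreover obtain i where "i \<in> I" "u \<in> U i" using I(3) by blast
      ultimately show "u \<in> (\<Union>i\<in>{i\<in>I. U i \<inter> strip r (r + \<eta>) \<noteq> {}}. U i)" by blast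
    qed
    show "\<exists>F\<in>?\<F>. \<exists>u\<in>F. dist z u < c + e - r" if z: "z \<in> ?W" for z
    proof -
      have fz: "c - e < f z" "f z < c + e"
        using z connected_component_subset[of "strip (c - e) (c + e)" x] by (auto simp: strip_def)
      \<comment> \<open>a height inside the thin strip and below \<open>z\<close>, whose height may be anywhere above \<open>r\<close>\<close>
      define r' where "r' = r + min \<eta> (f z - r) / 2"
      have r': "r < r'" "r' < r + \<eta>" "r' < f z" using fz r \<eta> by (auto simp: r'_def min_def field_simps)
      obtain u where u: "f u = r'" "dist z u = f z - r'" "connected_component {x. r' \<le> f x \<and> f x \<le> f z} z u"
        by (rule descend[of r' z]) (use r r' in auto)
      have "{x. r' \<le> f x \<and> f x \<le> f z} \<subseteq> strip r (c + e)" using r' fz by (auto simp: strip_def)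
      then have "connected_component (strip r (c + e)) z u" using u(3) connected_component_mono by blast
      moreover have "connected_component (strip r (c + e)) x z" using WK z by blast
      ultimately have "u \<in> ?K" using connected_component_trans by (metis mem_Collect_eq)
      moreover have us: "u \<in> strip r (r + \<eta>)" using r' u(1) by (simp add: strip_def)
      ultimately have "strip_component r (r + \<eta>) u \<in> ?\<F>" by blast
      moreover have "u \<in> strip_component r (r + \<eta>) u" using us by simp
      moreover have "dist z u < c + e - r" using u(2) fz r' by linarith
      ultimately show ?thesis by blast
    qed
  qed (use I \<F> in auto)
  also have "\<dots> \<le> sum d {i\<in>I. U i \<inter> strip r (r + \<eta>) \<noteq> {}}
    + 2 * (c + e - r) * real (Suc (the_enat (betti_number 1 (euclidean :: 'a topology))))"
    using \<F>(2) r \<eta> by (intro add_left_mono mult_left_mono) auto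
  finally show ?thesis .
qed

text \<open>
  Integration of the preceding bound over the height \<open>r\<close>, in the manner of the Eilenberg (coarea)
  inequality: a set of the cover with diameter \<open>d i\<close> meets thin strips only for heights in an
  interval of length \<open>d i + \<eta>\<close>, so it contributes at most \<open>d i * (d i + \<eta>)\<close>, whereas the left side
  integrates to about \<open>D\<^sup>2 / (4 N)\<close>.  The latter is the area of the triangle under \<open>D - 2 N s\<close>, where \<open>s\<close> is
  the depth, and only depths up to \<open>L = D / (2 N)\<close> matter.
\<close>

lemma strip_component_dist_sq_le:
  fixes U :: "'i \<Rightarrow> 'a set" and d :: "'i \<Rightarrow> real"
  assumes betti: "betti_number 1 (euclidean :: 'a topology) < \<infinity>"
    and xy: "x \<in> strip (c - e) (c + e)" "y \<in> strip_component (c - e) (c + e) x"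
    and e: "0 < e"
    and I: "finite I" "\<And>i. i \<in> I \<Longrightarrow> open (U i)" "(\<Union>i\<in>I. U i) = UNIV" "\<And>i. i \<in> I \<Longrightarrow> 0 \<le> d i"
      "\<And>i u v. \<lbrakk>i \<in> I; u \<in> U i; v \<in> U i\<rbrakk> \<Longrightarrow> dist u v \<le> d i"
    and N: "N = real (Suc (the_enat (betti_number 1 (euclidean :: 'a topology))))"
  shows "(dist x y)\<^sup>2 / (4 * N) \<le> (\<Sum>i\<in>I. (d i)\<^sup>2) + 2 * e * dist x y"
proof -
  define D where "D = dist x y"
  define R where "R = c + e"
  define L where "L = D / (2 * N)"
  have N1: "N \<ge> 1" by (simp add: N)
  have D0: "D \<ge> 0" by (simp add: D_def)
  have ys: "y \<in> strip (c - e) (c + e)" using xy(2) connected_component_subset by blast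
  have DR: "D < 2 * R"
    using xy(1) ys dist_triangle[of x y p] by (simp add: D_def R_def strip_def f_eq dist_commute)
  have *: "D\<^sup>2 / (4 * N) \<le> (\<Sum>i\<in>I. (d i)\<^sup>2) + \<eta> * sum d I + 2 * e * D" if \<eta>: "0 < \<eta>" "\<eta> \<le> 2 * e" for \<eta>
  proof (cases "L \<le> 2 * e")
    case True
    have "D\<^sup>2 / (4 * N) = D * L / 2" by (simp add: L_def power2_eq_square)
    also have "\<dots> \<le> D * (2 * e) / 2" using True D0 by (intro divide_right_mono mult_left_mono) auto
    also have "\<dots> \<le> 2 * e * D" using D0 e by simp
    finally show ?thesis using I(4) \<eta> by (smt (verit) mult_nonneg_nonneg sum_nonneg zero_le_power2)
  next
    case False
    define m where "m i = Inf (f ` U i)" for i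
    \<comment> \<open>the heights used remain positive, because both points have distance less than \<open>R\<close> to \<open>p\<close>\<close>
    have LR: "L < R" 
    proof -
      have "L \<le> D / 2" unfolding L_def using N1 D0 mult_left_mono[OF N1 D0] by (simp add: field_simps)
      then show ?thesis using DR by simp
    qed
    have fU: "m i \<le> f u \<and> f u \<le> m i + d i" if "i \<in> I" "u \<in> U i" for i u
    proof
      show "m i \<le> f u" unfolding m_def using that(2)
        by (intro cInf_lower) (auto intro: bdd_belowI[of _ 0])
      have "f u - d i \<le> m i" unfolding m_def
      proof (rule cInf_greatest)
        show "f ` U i \<noteq> {}" using that by blast
        fix t assume "t \<in> f ` U i"
        then obtain v where "v \<in> U i" "t = f v" by blast
        then show "f u - d i \<le> t" using I(5)[OF that, of v] f_Lipschitz[of u v] by linarith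
      qed
      then show "f u \<le> m i + d i" by simp
    qed
    let ?h = "\<lambda>i r. d i * indicat_real {m i - \<eta>..m i + d i} r"
    have pointwise: "D - 2 * N * (R - r) \<le> (\<Sum>i\<in>I. ?h i r)" if r: "r \<in> {R - L..R - 2 * e}" for r
    proof -
      have "D \<le> sum d {i\<in>I. U i \<inter> strip r (r + \<eta>) \<noteq> {}} + 2 * (c + e - r) * N"
        unfolding D_def N
        by (rule strip_component_dist_le_level_sum[OF betti xy _ _ \<eta> I])
          (use r LR in \<open>auto simp: R_def\<close>)
      also have "sum d {i\<in>I. U i \<inter> strip r (r + \<eta>) \<noteq> {}} \<le> (\<Sum>i\<in>{i\<in>I. U i \<inter> strip r (r + \<eta>) \<noteq> {}}. ?h i r)"
      proof (rule sum_mono)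
        fix i assume "i \<in> {i\<in>I. U i \<inter> strip r (r + \<eta>) \<noteq> {}}"
        then obtain u where "i \<in> I" "u \<in> U i" "u \<in> strip r (r + \<eta>)" by blast
        then have "r \<in> {m i - \<eta>..m i + d i}" using fU[of i u] by (auto simp: strip_def)
        then show "d i \<le> ?h i r" by simp
      qed
      also have "\<dots> \<le> (\<Sum>i\<in>I. ?h i r)"
        using I(1,4) by (intro sum_mono2) auto
      finally show ?thesis by (simp add: R_def algebra_simps)
    qed
    let ?S = "{R - L..R - 2 * e}"
    have "((\<lambda>r. D - 2 * N * (R - r)) has_integral
        (D * (R - 2 * e) + N * (R - (R - 2 * e))\<^sup>2) - (D * (R - L) + N * (R - (R - L))\<^sup>2)) ?S"
    proof (rule fundamental_theorem_of_calculus)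
      show "R - L \<le> R - 2 * e" using False by simp
      fix r assume "r \<in> ?S"
      have "((\<lambda>r. D * r + N * (R - r)\<^sup>2) has_real_derivative D - 2 * N * (R - r)) (at r within ?S)"
        by (auto intro!: derivative_eq_intros simp: algebra_simps)
      then show "((\<lambda>r. D * r + N * (R - r)\<^sup>2) has_vector_derivative D - 2 * N * (R - r)) (at r within ?S)"
        by (simp add: has_real_derivative_iff_has_vector_derivative)
    qed
    moreover have "((\<lambda>r. \<Sum>i\<in>I. ?h i r) has_integral (\<Sum>i\<in>I. d i * measure lebesgue ({m i - \<eta>..m i + d i} \<inter> ?S))) ?S"
    proof (intro has_integral_sum I(1) has_integral_mult_right)
      fix i assume "i \<in> I"
      have "{m i - \<eta>..m i + d i} \<inter> ?S \<in> lmeasurable"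
        by (simp add: Int_atLeastAtMost)
      then show "(indicat_real {m i - \<eta>..m i + d i} has_integral measure lebesgue ({m i - \<eta>..m i + d i} \<inter> ?S)) ?S"
        using integral_indicator integrable_on_indicator by (metis has_integral_integral)
    qed
    ultimately have "(D * (R - 2 * e) + N * (R - (R - 2 * e))\<^sup>2) - (D * (R - L) + N * (R - (R - L))\<^sup>2)
      \<le> (\<Sum>i\<in>I. d i * measure lebesgue ({m i - \<eta>..m i + d i} \<inter> ?S))"
      by (rule has_integral_le) (use pointwise in blast)
    also have "\<dots> \<le> (\<Sum>i\<in>I. d i * (d i + \<eta>))"
    proof (intro sum_mono mult_left_mono I(4))
      fix i assume i: "i \<in> I"
      have "measure lebesgue ({m i - \<eta>..m i + d i} \<inter> ?S) \<le> measure lebesgue {m i - \<eta>..m i + d i}"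
        by (intro measure_mono_fmeasurable) (auto simp: Int_atLeastAtMost)
      also have "\<dots> = d i + \<eta>" using I(4)[OF i] \<eta> by simp
      finally show "measure lebesgue ({m i - \<eta>..m i + d i} \<inter> ?S) \<le> d i + \<eta>" .
    qed
    also have "\<dots> = (\<Sum>i\<in>I. (d i)\<^sup>2) + \<eta> * sum d I"
      by (simp add: distrib_left sum.distrib power2_eq_square sum_distrib_left mult.commute)
    finally have "D * (L - 2 * e) + N * (2 * e)\<^sup>2 - N * L\<^sup>2 \<le> (\<Sum>i\<in>I. (d i)\<^sup>2) + \<eta> * sum d I"
      by (simp add: algebra_simps)
    moreover have "D * L - N * L\<^sup>2 = D\<^sup>2 / (4 * N)"
      using N1 by (simp add: L_def power2_eq_square field_simps)
    moreover have "N * (2 * e)\<^sup>2 \<ge> 0" using N1 by simp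
    ultimately show ?thesis by (simp add: algebra_simps)
  qed
  have S0: "sum d I \<ge> 0" using I(4) by (simp add: sum_nonneg)
  show ?thesis unfolding D_def[symmetric]
  proof (rule field_le_epsilon)
    fix \<epsilon> :: real assume \<epsilon>: "\<epsilon> > 0"
    define \<eta> where "\<eta> = min (2 * e) (\<epsilon> / (sum d I + 1))"
    have "0 < \<eta>" "\<eta> \<le> 2 * e" using e \<epsilon> S0 by (auto simp: \<eta>_def)
    moreover have "\<eta> * sum d I \<le> \<epsilon>"
    proof -
      have "\<eta> * sum d I \<le> \<epsilon> / (sum d I + 1) * sum d I" using S0 by (intro mult_right_mono) (auto simp: \<eta>_def)
      also have "\<dots> \<le> \<epsilon>" using S0 \<epsilon> by (simp add: field_simps)
      finally show ?thesis .
    qed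
    ultimately show "D\<^sup>2 / (4 * N) \<le> (\<Sum>i\<in>I. (d i)\<^sup>2) + 2 * e * D + \<epsilon>"
      using *[of \<eta>] by linarith
  qed
qed

end

section \<open>Walks through strip components\<close>

context pointed_geodesic_space
begin

text \<open>
  The strips of half-width \<open>e\<close> around the heights \<open>c0 + k * e\<close> overlap, and their components form the
  vertices of a graded graph, a discrete substitute for the Reeb graph.  It remains locally under
  control even where the Reeb quotient has infinitely many branch points.
\<close>

context
  fixes c0 e :: real
  assumes e: "e > 0"
begin

definition level :: "int \<Rightarrow> real" where
  "level k = c0 + of_int k * e"

lemma level_less_iff [simp]: "level k < level l \<longleftrightarrow> k < l"
  using e by (simp add: level_def)

lemma level_le_iff [simp]: "level k \<le> level l \<longleftrightarrow> k \<le> l"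
  using e by (simp add: level_def)

lemma level_eq_iff [simp]: "level k = level l \<longleftrightarrow> k = l"
  using e by (simp add: level_def)

abbreviation vertex_strip :: "int \<Rightarrow> 'a set" where
  "vertex_strip k \<equiv> strip (level (k - 1)) (level (k + 1))"

abbreviation lower_strip :: "int \<Rightarrow> 'a set" where
  "lower_strip k \<equiv> strip (level (k - 1)) (level k)"

text \<open>
  A vertex carries the index of its strip, since one set may be a component of several strips.
\<close>

definition is_vertex :: "int \<times> 'a set \<Rightarrow> bool" where
  "is_vertex v \<longleftrightarrow> (\<exists>y\<in>vertex_strip (fst v). snd v = connected_component_set (vertex_strip (fst v)) y)"

definition adjacent :: "int \<times> 'a set \<Rightarrow> int \<times> 'a set \<Rightarrow> bool" where
  "adjacent v v' \<longleftrightarrow> \<bar>fst v - fst v'\<bar> = 1 \<and> snd v \<inter> snd v' \<noteq> {}"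

text \<open>
  A vertex is branching if descending geodesics starting in it can leave through different
  components of the lower half of its strip.
\<close>

definition branching :: "int \<times> 'a set \<Rightarrow> bool" where
  "branching v \<longleftrightarrow> (\<exists>y\<in>snd v \<inter> lower_strip (fst v). \<exists>z\<in>snd v \<inter> lower_strip (fst v).
      z \<notin> connected_component_set (lower_strip (fst v)) y)"

lemma vertex_connected: "is_vertex v \<Longrightarrow> connected (snd v)"
  by (auto simp: is_vertex_def)

lemma vertex_nonempty: "is_vertex v \<Longrightarrow> snd v \<noteq> {}"
  unfolding is_vertex_def by (metis connected_component_eq_empty)

lemma vertex_subset: "is_vertex v \<Longrightarrow> snd v \<subseteq> vertex_strip (fst v)"
  unfolding is_vertex_def by (metis connected_component_subset)

lemma vertex_maximal:
  assumes "is_vertex v" "connected A" "A \<subseteq> vertex_strip (fst v)" "A \<inter> snd v \<noteq> {}"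
  shows "A \<subseteq> snd v"
proof -
  obtain y where y: "snd v = connected_component_set (vertex_strip (fst v)) y"
    using assms(1) by (auto simp: is_vertex_def)
  obtain a where "a \<in> A" "a \<in> snd v" using assms(4) by blast
  then have "A \<subseteq> connected_component_set (vertex_strip (fst v)) a"
    using assms(2,3) by (intro connected_component_maximal)
  moreover have "connected_component_set (vertex_strip (fst v)) y = connected_component_set (vertex_strip (fst v)) a"
    using connected_component_eq[of a "vertex_strip (fst v)" y] \<open>a \<in> snd v\<close> y by simp
  ultimately show ?thesis using y by simp
qed

lemma vertex_eq:
  assumes "is_vertex v" "is_vertex v'" "fst v = fst v'" "snd v \<inter> snd v' \<noteq> {}"
  shows "v = v'"
proof -
  have "snd v \<subseteq> snd v'" "snd v' \<subseteq> snd v"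
    using vertex_maximal[of v' "snd v"] vertex_maximal[of v "snd v'"] assms vertex_connected vertex_subset[of v] vertex_subset[of v']
    by (auto simp: Int_commute)
  then show ?thesis using assms(3) by (simp add: prod_eq_iff)
qed

lemma lower_component_subset_vertex:
  assumes "is_vertex v" "y \<in> snd v" "y \<in> lower_strip (fst v)"
  shows "connected_component_set (lower_strip (fst v)) y \<subseteq> snd v"
proof (rule vertex_maximal[OF assms(1)])
  have "level (fst v) < level (fst v + 1)" by simp
  then show "connected_component_set (lower_strip (fst v)) y \<subseteq> vertex_strip (fst v)"
    using connected_component_subset[of "lower_strip (fst v)" y] by (auto simp: strip_def simp del: level_less_iff)
  show "connected_component_set (lower_strip (fst v)) y \<inter> snd v \<noteq> {}"
    using assms(2) connected_component_refl[OF assms(3)] by blast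
qed auto

text \<open>
  Each branching vertex yields a loop down its two branches to \<open>p\<close>.  Its circle map belongs to a
  component inside the vertex, and different vertices at one height are disjoint.
\<close>

lemma card_branching_le:
  assumes betti: "betti_number 1 (euclidean :: 'a topology) < \<infinity>"
    and S: "finite S" "\<And>v. v \<in> S \<Longrightarrow> is_vertex v" "\<And>v. v \<in> S \<Longrightarrow> branching v"
  shows "card S \<le> the_enat (betti_number 1 (euclidean :: 'a topology))"
proof -
  have "\<forall>v\<in>S. \<exists>yz. fst yz \<in> snd v \<inter> lower_strip (fst v) \<and> snd yz \<in> snd v \<inter> lower_strip (fst v) \<and>
      snd yz \<notin> connected_component_set (lower_strip (fst v)) (fst yz)"
    using S(3) unfolding branching_def by fastforce
  from bchoice[OF this] obtain \<zeta> where \<zeta>: "\<forall>v\<in>S. fst (\<zeta> v) \<in> snd v \<inter> lower_strip (fst v) \<and>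
      snd (\<zeta> v) \<in> snd v \<inter> lower_strip (fst v) \<and> snd (\<zeta> v) \<notin> connected_component_set (lower_strip (fst v)) (fst (\<zeta> v))"
    by blast
  show ?thesis
  proof (rule independent_strip_components_card_le[OF betti S(1), where a = "\<lambda>v. level (fst v - 1)"
        and b = "\<lambda>v. level (fst v)" and c = "\<lambda>v. level (fst v + 1)" and z = "\<lambda>v. fst (\<zeta> v)" and z' = "\<lambda>v. snd (\<zeta> v)"])
    fix v assume v: "v \<in> S"
    show "connected_component (vertex_strip (fst v)) (fst (\<zeta> v)) (snd (\<zeta> v))"
      unfolding connected_component_def
      using vertex_connected vertex_subset S(2)[OF v] \<zeta> v by blast
  next
    fix v v' assume v: "v \<in> S" "v' \<in> S" "v \<noteq> v'" "level (fst v - 1) = level (fst v' - 1)"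
    then have eq: "fst v = fst v'" by simp
    have disj: "snd v \<inter> snd v' = {}" using vertex_eq S(2) v eq by blast
    have in_v: "fst (\<zeta> v) \<in> snd v" "snd (\<zeta> v) \<in> snd v" using \<zeta> v(1) by auto
    have "connected_component_set (lower_strip (fst v')) (fst (\<zeta> v')) \<subseteq> snd v'"
      using lower_component_subset_vertex[OF S(2)[OF v(2)]] \<zeta> v(2) by blast
    then show "level (fst v) = level (fst v') \<and>
        fst (\<zeta> v) \<notin> connected_component_set (lower_strip (fst v')) (fst (\<zeta> v')) \<and>
        snd (\<zeta> v) \<notin> connected_component_set (lower_strip (fst v')) (fst (\<zeta> v'))"
      using disj in_v eq by (simp add: disjoint_iff subset_iff) metis
  qed (use \<zeta> in auto)
qed

text \<open>
  Without branching, any point of \<open>v\<close> descends into the lower neighbour by itself, at cost at most \<open>e\<close>.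
  With branching it may choose the wrong branch, and a jump inside \<open>v\<close> repairs this.
\<close>

lemma step_down:
  assumes v: "is_vertex v" "is_vertex v'" "adjacent v v'" "fst v' = fst v - 1"
    and D: "\<And>y z. \<lbrakk>y \<in> snd v; z \<in> snd v\<rbrakk> \<Longrightarrow> dist y z \<le> D" and x: "x \<in> snd v"
  obtains x' where "x' \<in> snd v'" "dist x x' \<le> e + D * of_bool (branching v)"
proof -
  obtain q where q: "q \<in> snd v" "q \<in> snd v'" using v(3) by (auto simp: adjacent_def)
  show ?thesis
  proof (cases "branching v")
    case True
    then show ?thesis using that[OF q(2)] D[OF x q(1)] e by simp
  next
    case False
    \<comment> \<open>low enough to lie in the lower half of the strip, but not more than \<open>e\<close> below \<open>x\<close>\<close>
    define t where "t = min (f x) (max (f q) (f x - e))"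
    have lev: "level (fst v + 1) = level (fst v) + e" by (simp add: level_def algebra_simps)
    have fq: "level (fst v - 1) < f q" "f q < level (fst v)"
      using subsetD[OF vertex_subset[OF v(1)] q(1)] subsetD[OF vertex_subset[OF v(2)] q(2)] v(4)
      by (auto simp: strip_def)
    have fx: "level (fst v - 1) < f x" "f x < level (fst v + 1)"
      using subsetD[OF vertex_subset[OF v(1)] x] by (auto simp: strip_def)
    have t: "0 \<le> t" "t \<le> f x" "f x - e \<le> t" "level (fst v - 1) < t" "t < level (fst v)"
      using fq fx e lev f_nonneg[of q] f_nonneg[of x] unfolding t_def by linarith+
    obtain w where w: "f w = t" "dist x w = f x - t" "connected_component {z. t \<le> f z \<and> f z \<le> f x} x w"
      by (rule descend[OF t(1,2)])
    have "{z. t \<le> f z \<and> f z \<le> f x} \<subseteq> vertex_strip (fst v)" using t fx by (auto simp: strip_def)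
    with w(3) have "connected_component (vertex_strip (fst v)) x w" using connected_component_mono by blast
    then obtain A where A: "connected A" "A \<subseteq> vertex_strip (fst v)" "x \<in> A" "w \<in> A"
      unfolding connected_component_def by blast
    have wv: "w \<in> snd v" using vertex_maximal[OF v(1) A(1,2)] A(3,4) x by blast
    let ?E = "connected_component_set (lower_strip (fst v)) w"
    have wl: "w \<in> lower_strip (fst v)" "q \<in> lower_strip (fst v)" using w(1) t fq by (auto simp: strip_def)
    have qE: "q \<in> ?E" using False wl wv q(1) unfolding branching_def by blast
    have "?E \<subseteq> snd v'"
    proof (rule vertex_maximal[OF v(2)])
      have "level (fst v - 1 - 1) < level (fst v - 1)" by simp
      then show "?E \<subseteq> vertex_strip (fst v')"
        using connected_component_subset[of "lower_strip (fst v)" w] v(4) by (auto simp: strip_def simp del: level_less_iff)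
      show "?E \<inter> snd v' \<noteq> {}" using qE q(2) by blast
    qed auto
    moreover have "w \<in> ?E" using wl by simp
    ultimately have "w \<in> snd v'" by blast
    then show ?thesis using that[of w] w(2) t(3) False by simp
  qed
qed

definition walk :: "nat \<Rightarrow> (nat \<Rightarrow> int \<times> 'a set) \<Rightarrow> bool" where
  "walk n v \<longleftrightarrow> (\<forall>m\<le>n. is_vertex (v m)) \<and> (\<forall>m<n. adjacent (v m) (v (Suc m)))"

lemma adjacent_sym: "adjacent v v' \<Longrightarrow> adjacent v' v"
  by (auto simp: adjacent_def)

text \<open>
  At a local maximum of a walk without repetitions, the two lower neighbours are distinct and hence
  disjoint.
\<close>

lemma peak_branching:
  assumes v: "is_vertex v" "is_vertex u" "is_vertex u'" "adjacent v u" "adjacent v u'"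
    "fst u = fst v - 1" "fst u' = fst v - 1" "u \<noteq> u'"
  shows "branching v"
proof -
  obtain q q' where q: "q \<in> snd v" "q \<in> snd u" "q' \<in> snd v" "q' \<in> snd u'"
    using v(4,5) by (auto simp: adjacent_def)
  have "q \<in> lower_strip (fst v)"
    using subsetD[OF vertex_subset[OF v(1)] q(1)] subsetD[OF vertex_subset[OF v(2)] q(2)] v(6) by (auto simp: strip_def)
  moreover have "q' \<in> lower_strip (fst v)"
    using subsetD[OF vertex_subset[OF v(1)] q(3)] subsetD[OF vertex_subset[OF v(3)] q(4)] v(7) by (auto simp: strip_def)
  moreover have "q' \<notin> connected_component_set (lower_strip (fst v)) q"
  proof
    let ?E = "connected_component_set (lower_strip (fst v)) q"
    assume q'E: "q' \<in> ?E"
    have "?E \<subseteq> snd u"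
    proof (rule vertex_maximal[OF v(2)])
      have "level (fst v - 1 - 1) < level (fst v - 1)" by simp
      then show "?E \<subseteq> vertex_strip (fst u)"
        using connected_component_subset[of "lower_strip (fst v)" q] v(6) by (auto simp: strip_def simp del: level_less_iff)
      show "?E \<inter> snd u \<noteq> {}" using q(2) connected_component_refl[OF \<open>q \<in> lower_strip (fst v)\<close>] by blast
    qed auto
    then have "q' \<in> snd u \<inter> snd u'" using q'E q(4) by blast
    then show False using vertex_eq[OF v(2,3)] v(6-8) by auto
  qed
  ultimately show ?thesis using q unfolding branching_def by blast
qed

text \<open>
  Only descents are cheap, so the walk is consumed from its ends: an end whose first step leads down is
  moved by one step.  If both ends are at the foot of an ascent, the walk is split at a highest
  vertex.  This vertex is branching; it becomes an end vertex of both parts and the splitting yields one more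
  part, which explains the weight 3 of the interior branching vertices.  The summand 1 is for the
  two points that remain in one vertex at the very end.
\<close>

lemma injective_walk_dist_le:
  assumes wk: "walk n v" and inj: "inj_on v {..n}"
    and D: "\<And>u y z. \<lbrakk>is_vertex u; y \<in> snd u; z \<in> snd u\<rbrakk> \<Longrightarrow> dist y z \<le> D"
    and ij: "i \<le> j" "j \<le> n" and x: "x \<in> snd (v i)" and y: "y \<in> snd (v j)"
  defines "\<beta> \<equiv> \<lambda>m. of_bool (branching (v m)) :: real"
  shows "dist x y \<le> real (j - i) * e +
    D * (1 + 3 * (\<Sum>m\<in>{Suc i..<j}. \<beta> m) + (if i < j then \<beta> i + \<beta> j else 0))"
  using ij x y
proof (induction "j - i" arbitrary: i j x y rule: less_induct)
  case less
  have vert: "is_vertex (v m)" if "m \<le> n" for m using wk that by (simp add: walk_def)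
  have adj: "adjacent (v m) (v (Suc m))" if "m < n" for m using wk that by (simp add: walk_def)
  have D0: "D \<ge> 0" using D[OF vert[of i] less.prems(3) less.prems(3)] less.prems by simp
  have \<beta>0: "0 \<le> \<beta> m" "\<beta> m \<le> 1" for m by (auto simp: \<beta>_def)
  consider "i = j" | "i < j" "fst (v (Suc i)) = fst (v i) - 1" | "i < j" "fst (v (j - 1)) = fst (v j) - 1"
    | "i < j" "fst (v (Suc i)) \<noteq> fst (v i) - 1" "fst (v (j - 1)) \<noteq> fst (v j) - 1"
    using less.prems(1) by linarith
  then show ?case
  proof cases
    case 1
    then show ?thesis using D[OF vert[of i] less.prems(3), of y] less.prems by simp
  next
    case 2
    obtain x' where x': "x' \<in> snd (v (Suc i))" "dist x x' \<le> e + D * \<beta> i"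
    proof (rule step_down[of "v i" "v (Suc i)" D x])
      show "is_vertex (v i)" "is_vertex (v (Suc i))" "adjacent (v i) (v (Suc i))"
        using vert adj 2 less.prems by auto
      then show "\<And>y z. \<lbrakk>y \<in> snd (v i); z \<in> snd (v i)\<rbrakk> \<Longrightarrow> dist y z \<le> D" using D by blast
    qed (use 2 less.prems in \<open>auto simp: \<beta>_def\<close>)
    show ?thesis
    proof (cases "Suc i = j")
      case True
      have "dist x' y \<le> D" using D[OF vert[of j]] x'(1) less.prems True by auto
      then have "dist x y \<le> e + D * (1 + \<beta> i)"
        using x'(2) dist_triangle[of x y x'] by (simp add: algebra_simps)
      moreover have "D * \<beta> j \<ge> 0" using D0 \<beta>0 by simp
      ultimately show ?thesis using True[symmetric] by (simp add: algebra_simps)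
    next
      case False
      then have lt: "Suc i < j" using 2 by simp
      have "dist x' y \<le> real (j - Suc i) * e +
          D * (1 + 3 * (\<Sum>m\<in>{Suc (Suc i)..<j}. \<beta> m) + (\<beta> (Suc i) + \<beta> j))"
        using less.hyps[of j "Suc i" x' y] lt less.prems x'(1) by simp
      moreover have "(\<Sum>m\<in>{Suc i..<j}. \<beta> m) = \<beta> (Suc i) + (\<Sum>m\<in>{Suc (Suc i)..<j}. \<beta> m)"
        using lt by (rule sum.atLeast_Suc_lessThan)
      moreover have "real (j - i) = real (j - Suc i) + 1" using lt by simp
      moreover have "D * \<beta> (Suc i) \<ge> 0" using D0 \<beta>0 by simp
      ultimately show ?thesis
        using x'(2) dist_triangle[of x y x'] 2(1) by (simp add: algebra_simps)
    qed
  next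
    case 3
    obtain k where k: "j = Suc k" using 3(1) by (cases j) auto
    obtain y' where y': "y' \<in> snd (v k)" "dist y y' \<le> e + D * \<beta> j"
    proof (rule step_down[of "v j" "v k" D y])
      show "is_vertex (v j)" "is_vertex (v k)" "adjacent (v j) (v k)"
        using vert adjacent_sym[OF adj[of k]] k less.prems by auto
      then show "\<And>y z. \<lbrakk>y \<in> snd (v j); z \<in> snd (v j)\<rbrakk> \<Longrightarrow> dist y z \<le> D" using D by blast
    qed (use 3 less.prems k in \<open>auto simp: \<beta>_def\<close>)
    show ?thesis
    proof (cases "i = k")
      case True
      have "dist x y' \<le> D" using D[OF vert[of i]] y'(1) less.prems True k by auto
      then have "dist x y \<le> e + D * (1 + \<beta> j)"
        using y'(2) dist_triangle[of x y y'] by (simp add: algebra_simps dist_commute)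
      moreover have "D * \<beta> i \<ge> 0" using D0 \<beta>0 by simp
      ultimately show ?thesis using True k by (simp add: algebra_simps)
    next
      case False
      then have lt: "i < k" using 3 k by simp
      have "dist x y' \<le> real (k - i) * e +
          D * (1 + 3 * (\<Sum>m\<in>{Suc i..<k}. \<beta> m) + (\<beta> i + \<beta> k))"
        using less.hyps[of k i x y'] lt less.prems y'(1) k by simp
      moreover have "(\<Sum>m\<in>{Suc i..<j}. \<beta> m) = (\<Sum>m\<in>{Suc i..<k}. \<beta> m) + \<beta> k"
        using lt k by simp
      moreover have "real (j - i) = real (k - i) + 1" using lt k by simp
      moreover have "D * \<beta> k \<ge> 0" using D0 \<beta>0 by simp
      ultimately show ?thesis
        using y'(2) dist_triangle[of x y y'] 3(1) by (simp add: algebra_simps dist_commute)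
    qed
  next
    case 4
    define M where "M = Max ((\<lambda>m. fst (v m)) ` {i..j})"
    have "M \<in> (\<lambda>m. fst (v m)) ` {i..j}" unfolding M_def using 4 by (intro Max_in) auto
    then obtain m where m: "m \<in> {i..j}" "fst (v m) = M" by auto
    have top: "fst (v l) \<le> fst (v m)" if "l \<in> {i..j}" for l
      unfolding m(2) M_def using that by simp
    have diff: "\<bar>fst (v l) - fst (v (Suc l))\<bar> = 1" if "l < n" for l
      using adj[OF that] by (simp add: adjacent_def)
    have up: "fst (v (Suc i)) > fst (v i)" using diff[of i] 4 less.prems by linarith
    have down: "fst (v (j - 1)) > fst (v j)" using diff[of "j - 1"] 4 less.prems by simp linarith
    have mi: "m \<noteq> i" using up top[of "Suc i"] 4 by auto
    have "j - 1 \<in> {i..j}" using 4(1) by auto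
    from top[OF this] have mj: "m \<noteq> j" using down by auto
    obtain l where l: "m = Suc l" "i \<le> l" using mi m(1) by (cases m) auto
    have mlt: "i < m" "m < j" "m < n" using m(1) mi mj less.prems by auto
    have "branching (v m)"
    proof (rule peak_branching[of "v m" "v l" "v (Suc m)"])
      show "is_vertex (v m)" "is_vertex (v l)" "is_vertex (v (Suc m))" using vert mlt l by auto
      show "adjacent (v m) (v l)" using adjacent_sym[OF adj[of l]] mlt l by simp
      show "adjacent (v m) (v (Suc m))" using adj mlt by simp
      show "fst (v l) = fst (v m) - 1" using diff[of l] top[of l] mlt l by auto
      show "fst (v (Suc m)) = fst (v m) - 1" using diff[of m] top[of "Suc m"] mlt by auto
      show "v l \<noteq> v (Suc m)" using inj_onD[OF inj, of l "Suc m"] mlt l by auto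
    qed
    then have \<beta>m: "\<beta> m = 1" by (simp add: \<beta>_def)
    obtain z where z: "z \<in> snd (v m)" using vertex_nonempty[OF vert[of m]] mlt by auto
    define S1 where "S1 = (\<Sum>m\<in>{Suc i..<m}. \<beta> m)"
    define S2 where "S2 = (\<Sum>m\<in>{Suc m..<j}. \<beta> m)"
    have 1: "dist x z \<le> real (m - i) * e + D * (1 + 3 * S1 + (\<beta> i + 1))"
      using less.hyps[of m i x z] mlt less.prems z \<beta>m by (simp add: S1_def)
    have 2: "dist z y \<le> real (j - m) * e + D * (1 + 3 * S2 + (1 + \<beta> j))"
      using less.hyps[of j m z y] mlt less.prems z \<beta>m by (simp add: S2_def)
    have 3: "(\<Sum>m\<in>{Suc i..<j}. \<beta> m) = S1 + (1 + S2)"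
      using sum.atLeastLessThan_concat[of "Suc i" m j \<beta>] sum.atLeast_Suc_lessThan[of m j \<beta>] mlt \<beta>m
      by (simp add: S1_def S2_def)
    have "dist x y \<le> (real (m - i) * e + D * (1 + 3 * S1 + (\<beta> i + 1)))
        + (real (j - m) * e + D * (1 + 3 * S2 + (1 + \<beta> j)))"
      using 1 2 dist_triangle[of x y z] by linarith
    also have "\<dots> = (real (m - i) + real (j - m)) * e + D * (1 + 3 * (S1 + (1 + S2)) + (\<beta> i + \<beta> j))"
      by (simp add: distrib_left distrib_right)
    also have "real (m - i) + real (j - m) = real (j - i)" using mlt by simp
    finally show ?thesis unfolding 3 using 4(1) by simp
  qed
qed

text \<open>
  A shortest walk with given ends has no repetitions; otherwise the segment between two equal
  vertices could be cut out.
\<close>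

lemma walk_obtains_injective:
  assumes "walk n v"
  obtains n' v' where "walk n' v'" "inj_on v' {..n'}" "n' \<le> n" "v' 0 = v 0" "v' n' = v n"
proof -
  let ?P = "\<lambda>k. \<exists>u. walk k u \<and> u 0 = v 0 \<and> u k = v n"
  have P: "?P n" using assms by blast
  define k where "k = (LEAST k. ?P k)"
  have "?P k" unfolding k_def by (rule LeastI[of ?P, OF P])
  then obtain u where u: "walk k u" "u 0 = v 0" "u k = v n" by blast
  have kn: "k \<le> n" unfolding k_def by (rule Least_le[of ?P, OF P])
  have "u i \<noteq> u j" if ij: "i < j" "j \<le> k" for i j
  proof
    assume eq: "u i = u j"
    let ?u = "\<lambda>m. if m \<le> i then u m else u (m + (j - i))"
    have "walk (k - (j - i)) ?u"
      unfolding walk_def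
    proof (intro conjI allI impI)
      fix m assume m: "m \<le> k - (j - i)"
      then show "is_vertex (?u m)" using u(1) ij unfolding walk_def by auto
    next
      fix m assume m: "m < k - (j - i)"
      consider "Suc m \<le> i" | "m = i" | "i < m" by linarith
      then show "adjacent (?u m) (?u (Suc m))"
      proof cases
        case 2
        then have "adjacent (u j) (u (Suc j))" using u(1) m ij unfolding walk_def by auto
        moreover have "Suc i + (j - i) = Suc j" using ij by simp
        ultimately show ?thesis using 2 eq by simp
      qed (use u(1) m ij in \<open>auto simp: walk_def\<close>)
    qed
    moreover have "?u 0 = v 0" using u(2) by simp
    moreover have "?u (k - (j - i)) = v n"
    proof (cases "k - (j - i) \<le> i")
      case True
      then have "k = j" using ij by simp
      then show ?thesis using eq u(3) ij by simp
    qed (use u(3) ij in simp)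
    ultimately have "?P (k - (j - i))" by blast
    then have "k \<le> k - (j - i)" unfolding k_def by (rule Least_le)
    then show False using ij by simp
  qed
  then have "inj_on u {..k}" by (intro linorder_inj_onI) auto
  then show ?thesis using that u kn by blast
qed

lemma walk_dist_le:
  assumes betti: "betti_number 1 (euclidean :: 'a topology) < \<infinity>"
    and wk: "walk n v" and D: "\<And>u y z. \<lbrakk>is_vertex u; y \<in> snd u; z \<in> snd u\<rbrakk> \<Longrightarrow> dist y z \<le> D"
    and x: "x \<in> snd (v 0)" and y: "y \<in> snd (v n)"
  shows "dist x y \<le> real n * e + D * (1 + 3 * real (the_enat (betti_number 1 (euclidean :: 'a topology))))"
proof -
  obtain n' v' where v': "walk n' v'" "inj_on v' {..n'}" "n' \<le> n" "v' 0 = v 0" "v' n' = v n"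
    using walk_obtains_injective[OF wk] .
  define \<beta> where "\<beta> m = (of_bool (branching (v' m)) :: real)" for m
  have D0: "D \<ge> 0" using D[of "v 0" x x] x wk by (simp add: walk_def)
  let ?S = "{m \<in> {..n'}. branching (v' m)}"
  have "(\<Sum>m\<le>n'. \<beta> m) = real (card ?S)"
    unfolding \<beta>_def by (simp add: Int_def)
  also have "card ?S = card (v' ` ?S)"
    by (rule card_image[symmetric], rule inj_on_subset[OF v'(2)]) auto
  also have "\<dots> \<le> the_enat (betti_number 1 (euclidean :: 'a topology))"
    by (rule card_branching_le[OF betti]) (use v'(1) in \<open>auto simp: walk_def\<close>)
  finally have sum: "(\<Sum>m\<le>n'. \<beta> m) \<le> real (the_enat (betti_number 1 (euclidean :: 'a topology)))" by simp
  have "3 * (\<Sum>m\<in>{Suc 0..<n'}. \<beta> m) + (if 0 < n' then \<beta> 0 + \<beta> n' else 0) \<le> 3 * (\<Sum>m\<le>n'. \<beta> m)"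
  proof (cases "n' = 0")
    case False
    then have "{..n'} = insert 0 (insert n' {Suc 0..<n'})" by auto
    then have "(\<Sum>m\<le>n'. \<beta> m) = \<beta> 0 + (\<beta> n' + (\<Sum>m\<in>{Suc 0..<n'}. \<beta> m))" using False by simp
    then show ?thesis using False by (simp add: \<beta>_def)
  qed (simp add: \<beta>_def)
  then have "D * (1 + 3 * (\<Sum>m\<in>{Suc 0..<n'}. \<beta> m) + (if 0 < n' then \<beta> 0 + \<beta> n' else 0))
      \<le> D * (1 + 3 * real (the_enat (betti_number 1 (euclidean :: 'a topology))))"
    using sum D0 by (intro mult_left_mono) auto
  moreover have "real n' * e \<le> real n * e" using v'(3) e by simp
  moreover have "dist x y \<le> real (n' - 0) * e +
      D * (1 + 3 * (\<Sum>m\<in>{Suc 0..<n'}. \<beta> m) + (if 0 < n' then \<beta> 0 + \<beta> n' else 0))"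
    unfolding \<beta>_def by (rule injective_walk_dist_le[OF v'(1,2) D]) (use x y v' in auto)
  ultimately show ?thesis by simp
qed

end

end

section \<open>The Reeb quotient\<close>

lemma reeb_map_self: "x \<in> reeb_map f x"
  by (simp add: reeb_map_def)

lemma reeb_map_subset_fiber: "reeb_map f x \<subseteq> f -` {f x}"
  unfolding reeb_map_def by (rule connected_component_subset)

lemma connected_reeb_map: "connected (reeb_map f x)"
  by (simp add: reeb_map_def)

lemma reeb_map_eq: "z \<in> reeb_map f x \<Longrightarrow> reeb_map f z = reeb_map f x"
proof -
  assume z: "z \<in> reeb_map f x"
  then have "f z = f x" using reeb_map_subset_fiber[of f x] by auto
  then show ?thesis using connected_component_eq[of z "f -` {f x}" x] z by (simp add: reeb_map_def)
qed

lemma continuous_map_reeb_map: "continuous_map euclidean (reeb_space f) (reeb_map f)"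
  unfolding reeb_space_def by (intro quotient_imp_continuous_map quotient_map_quotient_topology)

lemma topspace_reeb_space: "topspace (reeb_space f) = range (reeb_map f)"
  by (simp add: reeb_space_def topspace_quotient_topology)

lemma openin_reeb_space: "openin (reeb_space f) W \<longleftrightarrow> W \<subseteq> range (reeb_map f) \<and> open {x. reeb_map f x \<in> W}"
  by (simp add: reeb_space_def openin_quotient_topology)

lemma continuous_map_reeb_fun:
  assumes "continuous_on UNIV f"
  shows "continuous_map (reeb_space f) euclideanreal (reeb_fun f)"
  unfolding continuous_map_def
proof (intro conjI allI impI)
  fix W :: "real set" assume "openin euclideanreal W"
  then have "open (f -` W)" using assms by (simp add: open_vimage)
  moreover have "{x. reeb_map f x \<in> {c \<in> topspace (reeb_space f). reeb_fun f c \<in> W}} = f -` W"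
    by (auto simp: topspace_reeb_space reeb_fun_reeb_map)
  ultimately show "openin (reeb_space f) {c \<in> topspace (reeb_space f). reeb_fun f c \<in> W}"
    by (auto simp: openin_reeb_space topspace_reeb_space)
qed auto

lemma reeb_dist_le_dist:
  fixes f :: "'a::metric_space \<Rightarrow> real"
  assumes geo: "geodesic_space (UNIV :: 'a set)" and Lip: "\<And>x y. \<bar>f x - f y\<bar> \<le> dist x y"
  shows "reeb_dist f (reeb_map f x) (reeb_map f y) \<le> ennreal (dist x y)"
proof -
  obtain g where g: "path g" "pathstart g = x" "pathfinish g = y" "path_length g = ennreal (dist x y)"
    using geo unfolding geodesic_space_def by blast
  have "continuous_map (top_of_set {0..1}) euclidean g" using g(1) by (simp add: path_def)
  then have "pathin (reeb_space f) (reeb_map f \<circ> g)"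
    unfolding pathin_def by (rule continuous_map_compose[OF _ continuous_map_reeb_map])
  then have "reeb_dist f (reeb_map f x) (reeb_map f y) \<le> path_length (reeb_fun f \<circ> (reeb_map f \<circ> g))"
    unfolding reeb_dist_def using g(2,3) by (intro INF_lower) (auto simp: pathstart_def pathfinish_def)
  also have "\<dots> \<le> path_length g"
    unfolding path_length_def
  proof (rule SUP_mono)
    fix nt :: "nat \<times> (nat \<Rightarrow> real)"
    assume nt: "nt \<in> {(n, t). mono_on {..n} t \<and> t ` {..n} \<subseteq> {0..1}}"
    show "\<exists>m\<in>{(n, t). mono_on {..n} t \<and> t ` {..n} \<subseteq> {0..1}}.
        (case nt of (n, t) \<Rightarrow> \<Sum>i<n. ennreal (dist ((reeb_fun f \<circ> (reeb_map f \<circ> g)) (t i)) ((reeb_fun f \<circ> (reeb_map f \<circ> g)) (t (Suc i)))))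
        \<le> (case m of (n, t) \<Rightarrow> \<Sum>i<n. ennreal (dist (g (t i)) (g (t (Suc i)))))"
      using nt Lip
      by (intro bexI[of _ nt]) (auto simp: reeb_fun_reeb_map dist_real_def intro!: sum_mono ennreal_leI)
  qed
  finally show ?thesis using g(4) by simp
qed

context pointed_geodesic_space
begin

text \<open>
  Fibers of the Reeb map are connected, so every component of a strip is a union of fibers, and
  distinct components have disjoint open images in the quotient.  A path in the quotient cannot pass from
  one image to another while its height stays in the strip.
\<close>

lemma reeb_path_stays_in_component:
  assumes \<beta>: "pathin (reeb_space f) \<beta>" and st: "0 \<le> s" "s \<le> t" "t \<le> 1"
    and range: "\<And>u. u \<in> {s..t} \<Longrightarrow> a < reeb_fun f (\<beta> u) \<and> reeb_fun f (\<beta> u) < b"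
    and y: "y \<in> \<beta> s" and u: "u \<in> {s..t}"
  shows "\<beta> u \<subseteq> strip_component a b y"
proof -
  let ?S = "strip a b" and ?C = "strip_component a b y"
  have cont: "continuous_map (top_of_set {0..1}) (reeb_space f) \<beta>" using \<beta> by (simp add: pathin_def)
  have point: "\<exists>z\<in>?S. \<beta> u = reeb_map f z" if "u \<in> {s..t}" for u
  proof -
    have "\<beta> u \<in> range (reeb_map f)"
      using continuous_map_image_subset_topspace[OF cont] that st by (auto simp: topspace_reeb_space)
    then obtain z where "\<beta> u = reeb_map f z" by blast
    then show ?thesis using range[OF that] by (auto simp: reeb_fun_reeb_map strip_def)
  qed
  have fiber: "reeb_map f z \<subseteq> strip_component a b z" if "z \<in> ?S" for z
    using that reeb_map_subset_fiber[of f z]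
    by (intro connected_component_maximal reeb_map_self connected_reeb_map) (auto simp: strip_def)
  have sat: "{z. reeb_map f z \<in> reeb_map f ` A} = A"
    if A: "\<And>z. z \<in> A \<Longrightarrow> strip_component a b z \<subseteq> A" "A \<subseteq> ?S" for A
    using fiber A reeb_map_self[of _ f] by blast
  have C: "strip_component a b z \<subseteq> ?C" if "z \<in> ?C" for z
    using connected_component_eq[OF that] by simp
  have D: "strip_component a b z \<subseteq> ?S - ?C" if "z \<in> ?S - ?C" for z
    using that connected_component_subset[of ?S z] connected_component_sym connected_component_trans
    by (smt (verit) Diff_iff mem_Collect_eq subset_iff)
  have opens: "openin (reeb_space f) (reeb_map f ` ?C)" "openin (reeb_space f) (reeb_map f ` (?S - ?C))"
    using sat[of ?C] sat[of "?S - ?C"] C D open_component[of ?S y] open_diff_component[of ?S y] connected_component_subset[of ?S y]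
    by (auto simp: openin_reeb_space)
  have con: "connectedin (reeb_space f) (\<beta> ` {s..t})"
    by (rule connectedin_continuous_map_image[OF cont])
      (use st in \<open>auto simp: connectedin_subtopology\<close>)
  have "\<beta> ` {s..t} \<subseteq> reeb_map f ` ?C \<union> reeb_map f ` (?S - ?C)"
    using point by blast
  moreover have disj: "reeb_map f ` ?C \<inter> reeb_map f ` (?S - ?C) = {}"
  proof (rule ccontr)
    assume "reeb_map f ` ?C \<inter> reeb_map f ` (?S - ?C) \<noteq> {}"
    then obtain z z' where z: "z \<in> ?C" "z' \<in> ?S - ?C" "reeb_map f z = reeb_map f z'" by auto
    have "z \<in> ?S" using z(1) connected_component_subset by blast
    then have "z' \<in> strip_component a b z" using fiber[of z] z(3) reeb_map_self[of z' f] by blast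
    then show False using C[OF z(1)] z(2) by blast
  qed
  moreover have "\<beta> s \<in> reeb_map f ` ?C"
  proof -
    obtain z where z: "z \<in> ?S" "\<beta> s = reeb_map f z" using point[of s] st by auto
    have "reeb_map f y = \<beta> s" using reeb_map_eq[of y f z] y z(2) by simp
    moreover have "f y = f z" using reeb_map_subset_fiber[of f z] y z(2) by auto
    then have "y \<in> ?C" using z(1) by (simp add: strip_def)
    ultimately show ?thesis by blast
  qed
  ultimately have "\<beta> ` {s..t} \<inter> reeb_map f ` (?S - ?C) = {}"
    using con opens st unfolding connectedin by (smt (verit) Int_assoc Int_commute Int_empty_right atLeastAtMost_iff disjoint_iff imageI)
  moreover have "\<beta> u \<in> \<beta> ` {s..t}" using u by blast
  moreover obtain z where "z \<in> ?S" "\<beta> u = reeb_map f z" using point[OF u] by blast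
  ultimately have "\<beta> u \<in> reeb_map f ` ?C" by blast
  then obtain z where z: "z \<in> ?C" "\<beta> u = reeb_map f z" by blast
  have "z \<in> ?S" using z(1) connected_component_subset by blast
  then show ?thesis using fiber[of z] C[OF z(1)] z(2) by blast
qed

text \<open>
  The path is followed in steps in which its height oscillates by less than \<open>\<eta>\<close>.  The current vertex is
  kept as long as the height stays within its strip and is replaced by a neighbour when the height
  leaves it.  At that moment the height is nearly central for the new strip, so a change of vertex uses up
  a variation of nearly \<open>e\<close>, and oscillation around one height does not produce further changes.
  This is the invariant \<open>Q\<close>, in which the distance to the central height acts as a potential.
\<close>

lemma reeb_path_walk:
  fixes V :: real
  assumes \<beta>: "pathin (reeb_space f) \<beta>" "\<beta> 0 = reeb_map f x" "\<beta> 1 = reeb_map f y"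
    and V: "path_length (reeb_fun f \<circ> \<beta>) \<le> ennreal V" "0 \<le> V"
    and e: "0 < e" and \<eta>: "0 < \<eta>" "3 * \<eta> < e"
  obtains n v where "walk (f x) e n v" "x \<in> snd (v 0)" "y \<in> snd (v n)" "real n * (e - 3 * \<eta>) \<le> V"
proof -
  define h where "h = reeb_fun f \<circ> \<beta>"
  have cont: "continuous_map (top_of_set {0..1}) (reeb_space f) \<beta>" using \<beta>(1) by (simp add: pathin_def)
  have ch: "continuous_on {0..1} h"
    using continuous_map_compose[OF cont continuous_map_reeb_fun[OF continuous_f]] by (simp add: h_def)
  obtain \<delta> where \<delta>: "\<delta> > 0" "\<And>s t. \<lbrakk>s \<in> {0..1}; t \<in> {0..1}; dist s t < \<delta>\<rbrakk> \<Longrightarrow> dist (h s) (h t) < \<eta>"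
    using compact_uniformly_continuous[OF ch compact_Icc] \<eta>(1) unfolding uniformly_continuous_on_def by metis
  obtain M where M: "inverse (real (Suc M)) < \<delta>" using reals_Archimedean[OF \<delta>(1)] by blast
  define \<tau> where "\<tau> j = real j / real (Suc M)" for j
  have \<tau>01: "0 \<le> \<tau> j" "j \<le> Suc M \<Longrightarrow> \<tau> j \<le> 1" for j by (auto simp: \<tau>_def divide_le_eq)
  have \<tau>mono: "i \<le> j \<Longrightarrow> \<tau> i \<le> \<tau> j" for i j by (auto simp: \<tau>_def divide_right_mono)
  have \<tau>Suc: "\<tau> (Suc j) = \<tau> j + inverse (real (Suc M))" for j by (simp add: \<tau>_def field_simps)
  have osc: "\<bar>h s - h (\<tau> j)\<bar> < \<eta>" if "s \<in> {\<tau> j..\<tau> (Suc j)}" "j < Suc M" for s j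
    using \<delta>(2)[of s "\<tau> j"] that M \<tau>Suc[of j] \<tau>01(1)[of j] \<tau>01(2)[of "Suc j"]
    by (auto simp: dist_real_def)
  let ?lev = "level (f x) e"
  have lev1: "?lev (k + 1) = ?lev k + e" "?lev (k - 1) = ?lev k - e" for k
    by (auto simp: level_def[OF e] algebra_simps)
  define Q where "Q j n v \<longleftrightarrow> walk (f x) e n v \<and> x \<in> snd (v 0) \<and> \<beta> (\<tau> j) \<subseteq> snd (v n) \<and>
      real n * (e - 3 * \<eta>) + \<bar>h (\<tau> j) - ?lev (fst (v n))\<bar> \<le> (\<Sum>i<j. \<bar>h (\<tau> (Suc i)) - h (\<tau> i)\<bar>)" for j n v
  have ne: "\<exists>z. z \<in> \<beta> t \<and> f z = h t" if "t \<in> {0..1}" for t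
  proof -
    have "\<beta> t \<in> range (reeb_map f)"
      using continuous_map_image_subset_topspace[OF cont] that by (auto simp: topspace_reeb_space)
    then obtain z where "\<beta> t = reeb_map f z" by blast
    then show ?thesis using reeb_map_self[of z f] by (auto simp: h_def reeb_fun_reeb_map)
  qed
  have "\<exists>n v. Q j n v" if "j \<le> Suc M" for j
    using that
  proof (induction j)
    case 0
    let ?v = "\<lambda>_::nat. (0::int, strip_component (?lev (0 - 1)) (?lev (0 + 1)) x)"
    have l0: "?lev 0 = f x" by (simp add: level_def[OF e])
    have xs: "x \<in> strip (?lev (0 - 1)) (?lev (0 + 1))" using lev1[of 0] l0 e by (simp add: strip_def)
    have "\<beta> 0 \<subseteq> strip_component (?lev (0 - 1)) (?lev (0 + 1)) x"
      unfolding \<beta>(2) using xs reeb_map_subset_fiber[of f x]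
      by (intro connected_component_maximal reeb_map_self connected_reeb_map) (auto simp: strip_def)
    moreover have "h 0 = f x" by (simp add: h_def \<beta>(2) reeb_fun_reeb_map)
    moreover have "walk (f x) e 0 ?v"
      unfolding walk_def[OF e] is_vertex_def[OF e] using xs by auto
    ultimately have "Q 0 0 ?v" using xs l0 by (simp add: Q_def \<tau>_def)
    then show ?case by blast
  next
    case (Suc j)
    then obtain n v where Q: "Q j n v" by auto
    have jM: "j < Suc M" using Suc.prems by simp
    define k where "k = fst (v n)"
    define c where "c = ?lev k"
    have vn: "is_vertex (f x) e (v n)" using Q by (simp add: Q_def walk_def[OF e])
    then obtain y0 where y0: "snd (v n) = strip_component (?lev (k - 1)) (?lev (k + 1)) y0"
      unfolding is_vertex_def[OF e] k_def by blast
    have \<tau>I: "\<tau> j \<in> {0..1}" "\<tau> (Suc j) \<in> {0..1}" "\<tau> j \<le> \<tau> (Suc j)"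
      using \<tau>01 \<tau>mono[of j "Suc j"] jM Suc.prems by auto
    obtain z where z: "z \<in> \<beta> (\<tau> j)" "f z = h (\<tau> j)" using ne[OF \<tau>I(1)] by blast
    have zC: "z \<in> snd (v n)" using Q z(1) by (auto simp: Q_def)
    have hj: "\<bar>h (\<tau> j) - c\<bar> < e"
      using subsetD[OF vertex_subset[OF e vn] zC] z(2) lev1[of k] by (auto simp: strip_def k_def c_def)
    have stay: "\<beta> u \<subseteq> strip_component (?lev (l - 1)) (?lev (l + 1)) z"
      if "\<And>s. s \<in> {\<tau> j..\<tau> (Suc j)} \<Longrightarrow> \<bar>h s - ?lev l\<bar> < e" "u \<in> {\<tau> j..\<tau> (Suc j)}" for l u
    proof (rule reeb_path_stays_in_component[OF \<beta>(1) _ \<tau>I(3) _ _ z(1) that(2)])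
      fix s assume "s \<in> {\<tau> j..\<tau> (Suc j)}"
      from that(1)[OF this] show "?lev (l - 1) < reeb_fun f (\<beta> s) \<and> reeb_fun f (\<beta> s) < ?lev (l + 1)"
        using lev1[of l] by (auto simp: h_def)
    qed (use \<tau>I in auto)
    show ?case
    proof (cases "\<forall>s\<in>{\<tau> j..\<tau> (Suc j)}. \<bar>h s - c\<bar> < e")
      case True
      have "strip_component (?lev (k - 1)) (?lev (k + 1)) z = snd (v n)"
        using zC connected_component_eq[of z _ y0] unfolding y0 by auto
      then have "\<beta> (\<tau> (Suc j)) \<subseteq> snd (v n)" using stay[of k "\<tau> (Suc j)"] True \<tau>I by (auto simp: c_def)
      then have "Q (Suc j) n v" using Q unfolding Q_def by auto
      then show ?thesis by blast
    next
      case False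
      then obtain s where s: "s \<in> {\<tau> j..\<tau> (Suc j)}" "e \<le> \<bar>h s - c\<bar>" by (auto simp: not_less)
      define k' where "k' = (if h (\<tau> j) > c then k + 1 else k - 1)"
      have far: "e - \<eta> < \<bar>h (\<tau> j) - c\<bar>" using osc[OF s(1) jM] s(2) by linarith
      have near: "\<bar>h (\<tau> j) - ?lev k'\<bar> < \<eta>"
        using far hj lev1[of k] \<eta> e by (auto simp: k'_def c_def split: if_splits)
      define C' where "C' = strip_component (?lev (k' - 1)) (?lev (k' + 1)) z"
      let ?v = "v(Suc n := (k', C'))"
      have zs: "z \<in> strip (?lev (k' - 1)) (?lev (k' + 1))"
        using near z(2) lev1[of k'] \<eta> by (auto simp: strip_def)
      have range: "\<bar>h s - ?lev k'\<bar> < e" if "s \<in> {\<tau> j..\<tau> (Suc j)}" for s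
        using osc[OF that jM] near \<eta> by linarith
      have "is_vertex (f x) e (k', C')" unfolding is_vertex_def[OF e] C'_def using zs by auto
      moreover have "adjacent (v n) (k', C')"
      proof -
        have "z \<in> C'" using zs by (simp add: C'_def)
        moreover have "\<bar>fst (v n) - k'\<bar> = 1" by (simp add: k'_def k_def)
        ultimately show ?thesis unfolding adjacent_def[OF e] using zC by auto
      qed
      ultimately have "walk (f x) e (Suc n) ?v"
        using Q unfolding Q_def walk_def[OF e] by (simp add: le_Suc_eq less_Suc_eq)
      moreover have "\<beta> (\<tau> (Suc j)) \<subseteq> C'" unfolding C'_def using stay[of k' "\<tau> (Suc j)"] range \<tau>I by auto
      moreover have "real (Suc n) * (e - 3 * \<eta>) + \<bar>h (\<tau> (Suc j)) - ?lev k'\<bar> \<le> (\<Sum>i<Suc j. \<bar>h (\<tau> (Suc i)) - h (\<tau> i)\<bar>)"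
      proof -
        have "real n * (e - 3 * \<eta>) + \<bar>h (\<tau> j) - c\<bar> \<le> (\<Sum>i<j. \<bar>h (\<tau> (Suc i)) - h (\<tau> i)\<bar>)"
          using Q by (simp add: Q_def c_def k_def)
        moreover have "\<bar>h (\<tau> (Suc j)) - ?lev k'\<bar> \<le> \<bar>h (\<tau> (Suc j)) - h (\<tau> j)\<bar> + \<bar>h (\<tau> j) - ?lev k'\<bar>" by linarith
        moreover have "real (Suc n) * (e - 3 * \<eta>) = real n * (e - 3 * \<eta>) + (e - 3 * \<eta>)" by (simp add: algebra_simps)
        ultimately show ?thesis using far near by simp
      qed
      ultimately have "Q (Suc j) (Suc n) ?v" using Q unfolding Q_def by simp
      then show ?thesis by blast
    qed
  qed
  then obtain n v where Q: "Q (Suc M) n v" by blast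
  have \<tau>1: "\<tau> (Suc M) = 1" by (simp add: \<tau>_def)
  have "ennreal (\<Sum>i<Suc M. dist (h (\<tau> i)) (h (\<tau> (Suc i)))) \<le> path_length h"
    by (rule path_length_ge_sum) (use \<tau>mono \<tau>01 in \<open>auto intro!: mono_onI\<close>)
  then have "ennreal (\<Sum>i<Suc M. dist (h (\<tau> i)) (h (\<tau> (Suc i)))) \<le> ennreal V"
    using V(1) unfolding h_def by (rule order_trans)
  then have "(\<Sum>i<Suc M. \<bar>h (\<tau> (Suc i)) - h (\<tau> i)\<bar>) \<le> V"
    using V(2) by (simp only: ennreal_le_iff dist_real_def abs_minus_commute)
  then have "real n * (e - 3 * \<eta>) \<le> V" using Q abs_ge_zero[of "h (\<tau> (Suc M)) - ?lev (fst (v n))"] unfolding Q_def by linarith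
  moreover have "y \<in> snd (v n)" using Q \<beta>(3) reeb_map_self[of y f] unfolding Q_def \<tau>1 by auto
  ultimately show ?thesis using that[of n v] Q unfolding Q_def by blast
qed

text \<open>
  The number of steps of the walk times \<open>e\<close> is at most \<open>V / (1 - e)\<close> if the oscillation \<open>e\<^sup>2 / 3\<close> is
  used, and each of the at most \<open>3 b\<^sub>1 + 1\<close> jumps costs at most the diameter of a vertex.  Both estimates
  become sharp enough in the limit where \<open>e\<close> tends to 0.
\<close>

lemma dist_le_reeb_path_length:
  fixes V H :: real
  assumes cpt: "compact (UNIV :: 'a set)"
    and betti: "betti_number 1 (euclidean :: 'a topology) < \<infinity>"
    and H: "hausdorff_measure 2 (UNIV :: 'a set) = ennreal H" "0 \<le> H"
    and \<beta>: "pathin (reeb_space f) \<beta>" "\<beta> 0 = reeb_map f x" "\<beta> 1 = reeb_map f y"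
    and V: "path_length (reeb_fun f \<circ> \<beta>) \<le> ennreal V" "0 \<le> V"
    and N: "N = real (the_enat (betti_number 1 (euclidean :: 'a topology))) + 1"
  shows "dist x y \<le> V + 3 * N * sqrt (4 * N * (4 / pi * H))"
proof -
  define M where "M = diameter (UNIV :: 'a set)"
  have M: "dist u v \<le> M" for u v :: 'a
    unfolding M_def using diameter_bounded_bound[OF compact_imp_bounded[OF cpt]] by blast
  have N1: "N \<ge> 1" by (simp add: N)
  have M0: "M \<ge> 0" using M[of x x] by simp
  define B where "B e = V / (1 - e) + 3 * N * sqrt (4 * N * (4 / pi * H + e + 2 * e * M))" for e
  have bound: "dist x y \<le> B e" if e: "0 < e" "e < 1" for e
  proof -
    define D where "D = sqrt (4 * N * (4 / pi * H + e + 2 * e * M))"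
    obtain I U d where cover: "finite (I :: nat set)" "\<And>i. open (U i)" "(\<Union>i\<in>I. U i) = (UNIV :: 'a set)" "\<And>i. 0 \<le> d i"
      "\<And>i u v. \<lbrakk>u \<in> U i; v \<in> U i\<rbrakk> \<Longrightarrow> dist u v \<le> d i" "(\<Sum>i\<in>I. (d i)\<^sup>2) \<le> 4 / pi * H + e"
      by (rule hausdorff_measure_2_finite_open_cover[OF cpt H e(1)]) blast
    have D: "dist u w \<le> D" if v: "is_vertex (f x) e v" "u \<in> snd v" "w \<in> snd v" for v u w
    proof -
      let ?c = "level (f x) e (fst v)"
      have lev: "level (f x) e (fst v - 1) = ?c - e" "level (f x) e (fst v + 1) = ?c + e"
        by (auto simp: level_def[OF e(1)] algebra_simps)
      have us: "u \<in> strip (?c - e) (?c + e)" using subsetD[OF vertex_subset[OF e(1) v(1)] v(2)] by (simp add: lev)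
      have "connected_component (strip (?c - e) (?c + e)) u w"
        unfolding connected_component_def
        using vertex_connected[OF e(1) v(1)] vertex_subset[OF e(1) v(1)] v(2,3) unfolding lev by blast
      then have "(dist u w)\<^sup>2 / (4 * N) \<le> (\<Sum>i\<in>I. (d i)\<^sup>2) + 2 * e * dist u w"
        by (intro strip_component_dist_sq_le[OF betti us _ e(1) cover(1), where U = U])
          (use cover N in auto)
      also have "\<dots> \<le> (4 / pi * H + e) + 2 * e * M"
        using cover(6) M e by (intro add_mono mult_left_mono) auto
      finally have "(dist u w)\<^sup>2 \<le> 4 * N * (4 / pi * H + e + 2 * e * M)"
        using N1 by (simp add: field_simps)
      then show ?thesis unfolding D_def by (rule real_le_rsqrt)
    qed
    have e2: "e\<^sup>2 < e" using e by (simp add: power2_eq_square)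
    have small: "0 < e\<^sup>2 / 3" "3 * (e\<^sup>2 / 3) < e" using e e2 by auto
    obtain n v where nv: "walk (f x) e n v" "x \<in> snd (v 0)" "y \<in> snd (v n)" "real n * (e - 3 * (e\<^sup>2 / 3)) \<le> V"
      by (rule reeb_path_walk[OF \<beta> V e(1) small])
    have "real n * e \<le> V / (1 - e)"
      using nv(4) e by (simp add: field_simps power2_eq_square)
    moreover have "dist x y \<le> real n * e + D * (1 + 3 * (N - 1))"
      using walk_dist_le[OF e(1) betti nv(1) D nv(2,3)] by (simp add: N)
    moreover have "D * (1 + 3 * (N - 1)) \<le> D * (3 * N)"
      unfolding D_def using N1 M0 H(2) e by (intro mult_left_mono) auto
    ultimately show ?thesis unfolding B_def D_def[symmetric] by (simp add: mult.commute)
  qed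
  have "(B \<longlongrightarrow> V / (1 - 0) + 3 * N * sqrt (4 * N * (4 / pi * H + 0 + 2 * 0 * M))) (at_right 0)"
    unfolding B_def by (intro tendsto_intros) auto
  moreover have "eventually (\<lambda>e. dist x y \<le> B e) (at_right 0)"
    using bound eventually_at_right_less[of 0] by (auto simp: eventually_at_right_field intro!: exI[of _ 1])
  ultimately have "dist x y \<le> V / (1 - 0) + 3 * N * sqrt (4 * N * (4 / pi * H + 0 + 2 * 0 * M))"
    by (intro tendsto_lowerbound) auto
  then show ?thesis by simp
qed

end

text \<open>
  This is where the constant 8 is used: \<open>3 * sqrt (16 / pi) \<le> 8\<close>, because \<open>pi \<ge> 9 / 4\<close>.
\<close>

lemma reeb_constant_le:
  fixes N H :: real
  assumes "N \<ge> 1" "H \<ge> 0"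
  shows "3 * N * sqrt (4 * N * (4 / pi * H)) \<le> 8 * N powr (3 / 2) * sqrt H"
proof -
  have "9 / 4 \<le> pi" using pi_gt3 by simp
  then have "16 / pi \<le> 64 / 9" by (simp add: field_simps)
  then have "4 * N * (4 / pi * H) \<le> (8 / 3)\<^sup>2 * (N * H)"
    using mult_right_mono[of "16 / pi" "64 / 9" "N * H"] assms by (simp add: power2_eq_square)
  then have "sqrt (4 * N * (4 / pi * H)) \<le> sqrt ((8 / 3)\<^sup>2 * (N * H))"
    by (rule real_sqrt_le_mono)
  also have "\<dots> = 8 / 3 * (sqrt N * sqrt H)" by (simp add: real_sqrt_mult)
  finally have "3 * N * sqrt (4 * N * (4 / pi * H)) \<le> 3 * N * (8 / 3 * (sqrt N * sqrt H))"
    using assms by (intro mult_left_mono) auto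
  moreover have "N powr (3 / 2) = N * sqrt N"
    using assms powr_add[of N 1 "1 / 2"] by (simp add: powr_half_sqrt)
  ultimately show ?thesis by (simp add: mult_ac)
qed

theorem theorem11:
  fixes p :: "'a::metric_space" and f :: "'a \<Rightarrow> real"
  assumes "compact (UNIV :: 'a set)"
    and "geodesic_space (UNIV :: 'a set)"
    and "betti_number 1 (euclidean :: 'a topology) < \<infinity>"
    and "hausdorff_dim (UNIV :: 'a set) = 2"
    and "\<And>x. f x = dist p x"
  shows "distortion (reeb_map f) (reeb_dist f)
    \<le> ennreal (8 * (real (the_enat (betti_number 1 (euclidean :: 'a topology))) + 1) powr (3 / 2))
        * ennreal_sqrt (hausdorff_measure 2 (UNIV :: 'a set))"
proof -
  interpret pointed_geodesic_space p f by unfold_locales (use assms in auto)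
  define N where "N = real (the_enat (betti_number 1 (euclidean :: 'a topology))) + 1"
  have N1: "N \<ge> 1" by (simp add: N_def)
  show ?thesis
  proof (cases "hausdorff_measure 2 (UNIV :: 'a set)")
    case top
    have "8 * N powr (3 / 2) > 0" using N1 by simp
    then show ?thesis
      unfolding N_def[symmetric] top by (simp add: ennreal_sqrt_def ennreal_mult_top)
  next
    case (real H)
    define K where "K = 8 * N powr (3 / 2) * sqrt H"
    have K0: "K \<ge> 0" using N1 real by (simp add: K_def)
    have lower: "ennreal (dist x y - K) \<le> reeb_dist f (reeb_map f x) (reeb_map f y)" for x y
      unfolding reeb_dist_def
    proof (rule INF_greatest)
      fix \<beta> assume "\<beta> \<in> {\<beta>. pathin (reeb_space f) \<beta> \<and> \<beta> 0 = reeb_map f x \<and> \<beta> 1 = reeb_map f y}"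
      then have \<beta>: "pathin (reeb_space f) \<beta>" "\<beta> 0 = reeb_map f x" "\<beta> 1 = reeb_map f y" by auto
      show "ennreal (dist x y - K) \<le> path_length (reeb_fun f \<circ> \<beta>)"
      proof (cases "path_length (reeb_fun f \<circ> \<beta>)")
        case V: (real V)
        have "dist x y \<le> V + 3 * N * sqrt (4 * N * (4 / pi * H))"
          by (rule dist_le_reeb_path_length[OF assms(1,3) real(2,1) \<beta> _ V(1) N_def]) (simp add: V)
        also have "\<dots> \<le> V + K"
          unfolding K_def by (intro add_left_mono reeb_constant_le N1 real)
        finally show ?thesis unfolding V(2) by (intro ennreal_leI) simp
      qed simp
    qed
    have "e2ennreal \<bar>ereal (dist x y) - enn2ereal (reeb_dist f (reeb_map f x) (reeb_map f y))\<bar> \<le> ennreal K" for x y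
    proof -
      have upper: "reeb_dist f (reeb_map f x) (reeb_map f y) \<le> ennreal (dist x y)"
        by (rule reeb_dist_le_dist[OF assms(2) f_Lipschitz])
      then obtain r where r: "0 \<le> r" "reeb_dist f (reeb_map f x) (reeb_map f y) = ennreal r"
        by (cases "reeb_dist f (reeb_map f x) (reeb_map f y)") (auto simp: top_unique)
      have "r \<le> dist x y" using upper r by (simp add: ennreal_le_iff)
      moreover have "dist x y - K \<le> r" using lower[of x y] r by (simp add: ennreal_le_iff)
      ultimately have "\<bar>dist x y - r\<bar> \<le> K" by linarith
      then show ?thesis using r by (simp add: enn2ereal_ennreal flip: ennreal.abs_eq)
    qed
    then have "distortion (reeb_map f) (reeb_dist f) \<le> ennreal K"
      unfolding distortion_def by (intro SUP_least)
    also have "ennreal K = ennreal (8 * N powr (3 / 2)) * ennreal_sqrt (hausdorff_measure 2 (UNIV :: 'a set))"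
      unfolding K_def real(2) ennreal_sqrt_def using N1 real(1) by (simp add: ennreal_mult)
    finally show ?thesis unfolding N_def .
  qed
qed

end
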